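(* Let $\omega$ be a real-valued continuous function on the open unit disk $\mathbf{D}$ with $\omega\in L^1(\mathbf{D})$. Then $\omega$ cannot have two distinct best harmonic approximants in $L^1$ whose difference is bounded. That is, if $h_1,h_2\in L^1_h(\mathbf{D})$ are both best approximants to $\omega$ in $L^1_h(\mathbf{D})$ and $h_1-h_2$ is bounded on $\mathbf{D}$, then $h_1=h_2$.
   Context: $\mathbf{D}$ is the open unit disk in the plane, with normalized area measure $dA=\frac1\pi\,dx\,dy$. $L^1_h(\mathbf{D})$ denotes the space of harmonic functions on $\mathbf{D}$ that are integrable with respect to $dA$. A function $h^\star\in L^1_h(\mathbf{D})$ is a best harmonic approximant to $\omega\in L^1(\mathbf{D})$ if $\|\omega-h^\star\|_{1}=\inf\{\|\omega-h\|_{1}:h\in L^1_h(\mathbf{D})\}$. *)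

theory Defs
  imports "HOL-Analysis.Analysis"
begin

text \<open>The plane is the type \<^typ>\<open>complex\<close>, whose standard basis as a real Euclidean
  space is \<open>{1, \<i>}\<close>; thus \<open>partial 1\<close> and \<open>partial \<i>\<close> are the partial derivatives
  in \<open>x\<close> and \<open>y\<close>.\<close>

definition partial ::
    "'a::euclidean_space \<Rightarrow> ('a \<Rightarrow> 'b::real_normed_vector) \<Rightarrow> 'a \<Rightarrow> 'b"
  where "partial v f z = vector_derivative (\<lambda>t::real. f (z + t *\<^sub>R v)) (at 0)"

definition C1_on :: "'a::euclidean_space set \<Rightarrow> ('a \<Rightarrow> 'b::real_normed_vector) \<Rightarrow> bool"
  where "C1_on S f \<longleftrightarrow>
    (\<forall>v\<in>Basis. (\<forall>z\<in>S. (\<lambda>t::real. f (z + t *\<^sub>R v)) differentiable at 0)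
      \<and> continuous_on S (partial v f))"

definition C2_on :: "'a::euclidean_space set \<Rightarrow> ('a \<Rightarrow> 'b::real_normed_vector) \<Rightarrow> bool"
  where "C2_on S f \<longleftrightarrow> C1_on S f \<and> (\<forall>v\<in>Basis. C1_on S (partial v f))"

definition laplacian :: "('a::euclidean_space \<Rightarrow> 'b::real_normed_vector) \<Rightarrow> 'a \<Rightarrow> 'b"
  where "laplacian f z = (\<Sum>v\<in>Basis. partial v (partial v f) z)"

definition harmonic_on :: "'a::euclidean_space set \<Rightarrow> ('a \<Rightarrow> 'b::real_normed_vector) \<Rightarrow> bool"
  where "harmonic_on S f \<longleftrightarrow> open S \<and> C2_on S f \<and> (\<forall>z\<in>S. laplacian f z = 0)"

abbreviation unit_disk :: "complex set"
  where "unit_disk \<equiv> ball 0 1"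

definition disk_area :: "complex measure"
  where "disk_area = scale_measure (ennreal (1 / pi)) (lebesgue_on unit_disk)"

text \<open>Scalars are complex. Functions are total on \<^typ>\<open>complex\<close>, but everything below
  depends only on their values on the disk: \<^const>\<open>disk_area\<close> lives there, and the disk is open.\<close>

definition L1_norm :: "(complex \<Rightarrow> complex) \<Rightarrow> real"
  where "L1_norm f = (\<integral>z. norm (f z) \<partial>disk_area)"

definition L1_harmonic :: "(complex \<Rightarrow> complex) set"
  where "L1_harmonic = {h. harmonic_on unit_disk h \<and> integrable disk_area h}"

definition best_harmonic_approximant :: "(complex \<Rightarrow> complex) \<Rightarrow> (complex \<Rightarrow> complex) \<Rightarrow> bool"
  where "best_harmonic_approximant w h \<longleftrightarrow>
    h \<in> L1_harmonic \<and>
    L1_norm (\<lambda>z. w z - h z) = (INF g\<in>L1_harmonic. L1_norm (\<lambda>z. w z - g z))"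

end

theory Submission
  imports Defs "HOL-Complex_Analysis.Complex_Analysis"
begin

text \<open>Best approximants \<open>h1\<close>, \<open>h2\<close> are real-valued, and equality in the triangle inequality for their
  midpoint shows that \<open>f = \<omega> - (h1 + h2)/2\<close> vanishes only where \<open>u = h1 - h2\<close> does. If \<open>u\<close> is not
  identically zero, its zero set is negligible, so optimality of the midpoint says that \<open>\<sigma> = sgn f\<close>
  annihilates all integrable harmonic functions. Consequently the Cauchy transform \<open>K\<close> of \<open>\<sigma>\<close>, which is
  continuous on the plane, vanishes on the unit circle. Near a point where \<open>u \<noteq> 0\<close>, \<open>\<sigma>\<close> is a constant \<open>s\<close>,
  and \<open>H z = z * K z - pi * s * (\<bar>z\<bar>\<^sup>2 - 1)\<close> is holomorphic; it also vanishes on the circle. Let \<open>F\<close> be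
  holomorphic on the disk with \<open>\<bar>u\<bar> = Re F\<close> near the point. The maximum principle for \<open>H * exp (N * F)\<close>
  with \<open>N\<close> large forces \<open>H = 0\<close>, because \<open>u\<close> is bounded and vanishes on the remaining boundary. So
  \<open>\<bar>z * K z\<bar> = pi * (1 - \<bar>z\<bar>\<^sup>2)\<close> on a dense set, which is impossible near \<open>0\<close>.\<close>

subsection \<open>Harmonic functions as sums of holomorphic and antiholomorphic functions\<close>

text \<open>\<open>C1_on\<close> speaks of the parameter value 0 only; moving the base point along
  the line yields a derivative at every \<open>t\<close>, the form required by the fundamental
  theorem of calculus.\<close>

lemma has_vector_derivative_partial:
  assumes "C1_on S f" "v \<in> Basis" "z + t *\<^sub>R v \<in> S"
  shows "((\<lambda>t. f (z + t *\<^sub>R v)) has_vector_derivative partial v f (z + t *\<^sub>R v)) (at t)"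
proof -
  have "(\<lambda>s. f (z + t *\<^sub>R v + s *\<^sub>R v)) differentiable at 0"
    using assms unfolding C1_on_def by auto
  then have *: "((\<lambda>s. f (z + t *\<^sub>R v + s *\<^sub>R v)) has_vector_derivative partial v f (z + t *\<^sub>R v)) (at (t - t))"
    unfolding partial_def by (simp add: vector_derivative_works)
  have "((\<lambda>x. x - t) has_vector_derivative 1) (at t)"
    by (auto intro!: derivative_eq_intros)
  from vector_diff_chain_at[OF this *] show ?thesis
    by (simp add: o_def algebra_simps)
qed

lemma partial_eqI:
  assumes "((\<lambda>t. f (z + t *\<^sub>R v)) has_vector_derivative d) (at 0)"
  shows "partial v f z = d"
  using assms unfolding partial_def by (rule vector_derivative_at)

lemma open_contains_square:
  fixes z :: complex
  assumes "open S" "z \<in> S"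
  obtains r where "r > 0" "\<And>x y. \<bar>x\<bar> < r \<Longrightarrow> \<bar>y\<bar> < r \<Longrightarrow> z + x *\<^sub>R 1 + y *\<^sub>R \<i> \<in> S"
proof -
  obtain r where r: "r > 0" "ball z r \<subseteq> S" using assms openE by blast
  show ?thesis
  proof (rule that[of "r / 2"])
    fix x y :: real assume xy: "\<bar>x\<bar> < r / 2" "\<bar>y\<bar> < r / 2"
    have "norm (x *\<^sub>R 1 + y *\<^sub>R \<i>) \<le> \<bar>x\<bar> + \<bar>y\<bar>"
      by (rule order_trans[OF norm_triangle_ineq]) (simp add: norm_mult)
    also have "\<dots> < r" using xy by simp
    finally have "z + x *\<^sub>R 1 + y *\<^sub>R \<i> \<in> ball z r"
      by (simp add: dist_norm norm_minus_commute algebra_simps)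
    then show "z + x *\<^sub>R 1 + y *\<^sub>R \<i> \<in> S" using r by auto
  qed (use r in simp)
qed

text \<open>Continuous partials give total differentiability: in the real coordinates of
  \<open>p\<close> this is \<open>has_derivative_partialsI\<close>, and taking real and imaginary
  parts of \<open>w - z\<close> carries the result back to the plane.\<close>

lemma C1_on_has_derivative:
  fixes f :: "complex \<Rightarrow> 'b::real_normed_vector"
  assumes C1: "C1_on S f" and S: "open S" "z \<in> S"
  shows "(f has_derivative (\<lambda>w. Re w *\<^sub>R partial 1 f z + Im w *\<^sub>R partial \<i> f z)) (at z)"
proof -
  obtain r where r: "r > 0" "\<And>x y. \<bar>x\<bar> < r \<Longrightarrow> \<bar>y\<bar> < r \<Longrightarrow> z + x *\<^sub>R 1 + y *\<^sub>R \<i> \<in> S"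
    using open_contains_square[OF S] by metis
  define X where "X = {-r<..<r}"
  have X: "open X" "convex X" "0 \<in> X" using r by (auto simp: X_def)
  define p where "p = (\<lambda>x y. z + x *\<^sub>R 1 + y *\<^sub>R \<i>)"
  have pS: "p x y \<in> S" if "x \<in> X" "y \<in> X" for x y
    unfolding p_def by (rule r(2)) (use that in \<open>auto simp: X_def\<close>)
  have cont: "continuous_on S (partial \<i> f)"
    using C1 unfolding C1_on_def Basis_complex_def by auto
  have "((\<lambda>(x, y). f (p x y)) has_derivative
     (\<lambda>(tx, ty). tx *\<^sub>R partial 1 f (p 0 0) + blinfun_apply (blinfun_scaleR_left (partial \<i> f (p 0 0))) ty)) (at (0, 0) within X \<times> X)"
  proof (rule has_derivative_partialsI[where fy = "\<lambda>x y. blinfun_scaleR_left (partial \<i> f (p x y))"])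
    show "((\<lambda>x. f (p x 0)) has_derivative (\<lambda>tx. tx *\<^sub>R partial 1 f (p 0 0))) (at 0 within X)"
      using has_vector_derivative_partial[OF C1, of 1 z 0] pS[of 0 0] X
      by (auto simp: p_def has_vector_derivative_def Basis_complex_def intro: has_derivative_at_withinI)
    show "((\<lambda>y. f (p x y)) has_derivative blinfun_apply (blinfun_scaleR_left (partial \<i> f (p x y)))) (at y within X)"
      if "x \<in> X" "y \<in> X" for x y
      using has_vector_derivative_partial[OF C1, of \<i> "z + x *\<^sub>R 1" y] pS[OF that]
      by (auto simp: p_def has_vector_derivative_def Basis_complex_def intro: has_derivative_at_withinI)
    have "continuous_on (X \<times> X) (\<lambda>(x, y). blinfun_scaleR_left (partial \<i> f (p x y)))"
    proof -
      have "continuous_on (X \<times> X) (\<lambda>q. p (fst q) (snd q))"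
        unfolding p_def by (intro continuous_intros)
      then have "continuous_on (X \<times> X) (\<lambda>q. partial \<i> f (p (fst q) (snd q)))"
        by (rule continuous_on_compose2[OF cont]) (auto simp: pS)
      then show ?thesis
        unfolding split_beta by (rule bounded_linear.continuous_on[OF bounded_linear_blinfun_scaleR_left])
    qed
    then show "continuous (at (0,0) within X \<times> X) (\<lambda>(x, y). blinfun_scaleR_left (partial \<i> f (p x y)))"
      using X by (simp add: continuous_on_eq_continuous_within)
  qed (use X in auto)
  then have D: "((\<lambda>(x, y). f (p x y)) has_derivative
     (\<lambda>(tx, ty). tx *\<^sub>R partial 1 f z + ty *\<^sub>R partial \<i> f z)) (at (0, 0))"
    using X by (simp add: at_within_open[OF _ open_Times] p_def)
  have L: "((\<lambda>w. (Re (w - z), Im (w - z))) has_derivative (\<lambda>w. (Re w, Im w))) (at z)"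
    by (auto intro!: derivative_eq_intros)
  have "((\<lambda>w. case (Re (w - z), Im (w - z)) of (x, y) \<Rightarrow> f (p x y)) has_derivative
     (\<lambda>w. case (Re w, Im w) of (tx, ty) \<Rightarrow> tx *\<^sub>R partial 1 f z + ty *\<^sub>R partial \<i> f z)) (at z)"
    by (rule has_derivative_compose[OF L]) (use D in simp)
  moreover have "p (Re (w - z)) (Im (w - z)) = w" for w
    by (auto simp: p_def complex_eq_iff)
  ultimately show ?thesis by simp
qed

text \<open>Write increments of \<open>f\<close> in \<open>y\<close> as integrals of
  \<open>partial \<i> f\<close> along vertical segments, differentiate under the integral sign in
  \<open>x\<close>, and then differentiate with respect to the upper limit \<open>y\<close>.\<close>

lemma C2_on_mixed_partials:
  fixes f :: "complex \<Rightarrow> complex"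
  assumes C2: "C2_on S f" and S: "open S" "z \<in> S"
  shows "partial \<i> (partial 1 f) z = partial 1 (partial \<i> f) z"
proof -
  obtain r where r: "r > 0" "\<And>x y. \<bar>x\<bar> < r \<Longrightarrow> \<bar>y\<bar> < r \<Longrightarrow> z + x *\<^sub>R 1 + y *\<^sub>R \<i> \<in> S"
    using open_contains_square[OF S] by metis
  define X where "X = {-r<..<r}"
  define d where "d = r/2"
  have X: "open X" "convex X" "0 \<in> X" and d: "d > 0" "{-d..d} \<subseteq> X"
    using r by (auto simp: X_def d_def)
  have dX: "t \<in> X" if "-d \<le> t" "t \<le> d" for t using d(2) that by auto
  define p where "p = (\<lambda>x y. z + x *\<^sub>R 1 + y *\<^sub>R \<i>)"
  have pS: "p x y \<in> S" if "x \<in> X" "y \<in> X" for x y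
    unfolding p_def by (rule r(2)) (use that in \<open>auto simp: X_def\<close>)
  have p_alt: "p x y = z + y *\<^sub>R \<i> + x *\<^sub>R 1" for x y by (simp add: p_def)
  have B: "(1::complex) \<in> Basis" "\<i> \<in> Basis" by (auto simp: Basis_complex_def)
  have C1: "C1_on S f" "C1_on S (partial 1 f)" "C1_on S (partial \<i> f)"
    using C2 B unfolding C2_on_def by auto
  have cont: "continuous_on S (partial \<i> f)" "continuous_on S (partial 1 (partial \<i> f))"
    using C1 B unfolding C1_on_def by auto
  have contp: "continuous_on (A \<times> B) (\<lambda>(x, y). p x y)" for A B
    unfolding split_beta p_def by (intro continuous_intros)
  have dy: "((\<lambda>y. g (p x y)) has_vector_derivative partial \<i> g (p x y)) (at y)"
    if "x \<in> X" "y \<in> X" "C1_on S g" for x y and g :: "complex \<Rightarrow> complex"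
    using has_vector_derivative_partial[OF that(3) B(2), of "z + x *\<^sub>R 1" y] pS[OF that(1,2)] by (simp add: p_def)
  have dx: "((\<lambda>x. g (p x y)) has_vector_derivative partial 1 g (p x y)) (at x)"
    if "x \<in> X" "y \<in> X" "C1_on S g" for x y and g :: "complex \<Rightarrow> complex"
    using has_vector_derivative_partial[OF that(3) B(1), of "z + y *\<^sub>R \<i>" x] pS[OF that(1,2)] unfolding p_alt by simp
  have cy: "continuous_on {-d..d} (\<lambda>t. g (p x t))" if "x \<in> X" "continuous_on S g" for x and g :: "complex \<Rightarrow> complex"
  proof (rule continuous_on_compose2[OF that(2)])
    show "continuous_on {-d..d} (p x)" unfolding p_def by (intro continuous_intros)
    show "p x ` {-d..d} \<subseteq> S" using dX pS[OF that(1)] by auto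
  qed
  have ftc: "f (p x y) - f (p x (-d)) = integral (cbox (-d) y) (\<lambda>t. partial \<i> f (p x t))" if "x \<in> X" "y \<in> {-d..d}" for x y
  proof -
    have "((\<lambda>t. partial \<i> f (p x t)) has_integral f (p x y) - f (p x (-d))) {-d..y}"
    proof (rule fundamental_theorem_of_calculus)
      show "((\<lambda>t. f (p x t)) has_vector_derivative partial \<i> f (p x t)) (at t within {-d..y})"
        if "t \<in> {-d..y}" for t
        by (rule has_vector_derivative_at_within, rule dy) (use \<open>x \<in> X\<close> \<open>y \<in> {-d..d}\<close> that C1 in \<open>auto intro: dX\<close>)
    qed (use that in auto)
    then show ?thesis by (simp add: integral_unique)
  qed
  have sub: "{-d..y} \<subseteq> {-d..d}" if "y \<in> {-d..d}" for y using that by auto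
  \<comment> \<open>The integral over the vertical segment, as a function of \<open>x\<close>, has
    two derivatives at 0: one from the Leibniz rule and one read off from \<open>ftc\<close>. They
    must agree.\<close>
  have eq: "partial 1 f (p 0 y) = partial 1 f (p 0 (-d)) + integral {-d..y} (\<lambda>t. partial 1 (partial \<i> f) (p 0 t))"
    if y: "y \<in> {-d..d}" for y
  proof -
    have "((\<lambda>x. integral (cbox (-d) y) (\<lambda>t. partial \<i> f (p x t))) has_vector_derivative
            integral (cbox (-d) y) (\<lambda>t. partial 1 (partial \<i> f) (p 0 t))) (at 0 within X)"
    proof (rule leibniz_rule_vector_derivative[where fx = "\<lambda>x t. partial 1 (partial \<i> f) (p x t)"])
      show "((\<lambda>x. partial \<i> f (p x t)) has_vector_derivative partial 1 (partial \<i> f) (p x t)) (at x within X)"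
        if "x \<in> X" "t \<in> cbox (-d) y" for x t
        by (rule has_vector_derivative_at_within, rule dx) (use that y dX C1 in simp_all)
      show "(\<lambda>t. partial \<i> f (p x t)) integrable_on cbox (-d) y" if "x \<in> X" for x
        using continuous_on_subset[OF cy[OF that cont(1)] sub[OF y]] by (auto intro: integrable_continuous_interval)
      show "continuous_on (X \<times> cbox (-d) y) (\<lambda>(x, t). partial 1 (partial \<i> f) (p x t))"
        unfolding split_beta
      proof (rule continuous_on_compose2[OF cont(2) contp[unfolded split_beta]])
        have "p a b \<in> S" if "a \<in> X" "b \<in> {-d..y}" for a b
          using that y dX[of b] by (intro pS) auto
        then show "(\<lambda>q. p (fst q) (snd q)) ` (X \<times> cbox (-d) y) \<subseteq> S"
          by auto
      qed
    qed (use X in simp_all)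
    moreover have "((\<lambda>x. integral (cbox (-d) y) (\<lambda>t. partial \<i> f (p x t))) has_vector_derivative
            partial 1 f (p 0 y) - partial 1 f (p 0 (-d))) (at 0 within X)"
    proof (rule has_vector_derivative_transform[where f = "\<lambda>x. f (p x y) - f (p x (-d))"])
      show "((\<lambda>x. f (p x y) - f (p x (-d))) has_vector_derivative
            partial 1 f (p 0 y) - partial 1 f (p 0 (-d))) (at 0 within X)"
      proof (rule has_vector_derivative_at_within, rule has_vector_derivative_diff)
        have "y \<in> X" "-d \<in> X" using y d(1) by (auto intro: dX)
        from dx[OF X(3) this(1) C1(1)] dx[OF X(3) this(2) C1(1)]
        show "((\<lambda>x. f (p x y)) has_vector_derivative partial 1 f (p 0 y)) (at 0)"
          "((\<lambda>x. f (p x (-d))) has_vector_derivative partial 1 f (p 0 (-d))) (at 0)" .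
      qed
    qed (use X(3) y ftc in simp_all)
    ultimately have "integral (cbox (-d) y) (\<lambda>t. partial 1 (partial \<i> f) (p 0 t)) = partial 1 f (p 0 y) - partial 1 f (p 0 (-d))"
      unfolding at_within_open[OF X(3,1)] by (rule vector_derivative_unique_at)
    then show ?thesis by simp
  qed
  \<comment> \<open>Starting the integral at \<open>-d\<close> makes 0 an interior point of the
    interval, so the derivative within it is a two-sided one.\<close>
  have "((\<lambda>y. integral {-d..y} (\<lambda>t. partial 1 (partial \<i> f) (p 0 t))) has_vector_derivative partial 1 (partial \<i> f) (p 0 0)) (at 0 within {-d..d})"
    by (rule integral_has_vector_derivative[OF cy[OF X(3) cont(2)]]) (use d(1) in auto)
  then have "((\<lambda>y. integral {-d..y} (\<lambda>t. partial 1 (partial \<i> f) (p 0 t))) has_vector_derivative partial 1 (partial \<i> f) (p 0 0)) (at 0)"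
    using d(1) at_within_interior[of 0 "{-d..d}"] by simp
  then have "((\<lambda>y. partial 1 f (p 0 (-d)) + integral {-d..y} (\<lambda>t. partial 1 (partial \<i> f) (p 0 t))) has_vector_derivative 0 + partial 1 (partial \<i> f) (p 0 0)) (at 0)"
    by (intro has_vector_derivative_add has_vector_derivative_const)
  then have "((\<lambda>y. partial 1 f (p 0 y)) has_vector_derivative 0 + partial 1 (partial \<i> f) (p 0 0)) (at 0)"
  proof (rule has_vector_derivative_transform_within_open[where S = "{-d<..<d}"])
    show "partial 1 f (p 0 (-d)) + integral {-d..y} (\<lambda>t. partial 1 (partial \<i> f) (p 0 t)) = partial 1 f (p 0 y)"
      if "y \<in> {-d<..<d}" for y
      by (rule eq[symmetric]) (use that in auto)
  qed (use d(1) in auto)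
  with dy[OF X(3) X(3) C1(2)] have "partial \<i> (partial 1 f) (p 0 0) = partial 1 (partial \<i> f) (p 0 0)"
    using vector_derivative_unique_at by fastforce
  then show ?thesis by (simp add: p_def)
qed

lemma C1_on_holomorphic_plus_cnj:
  assumes S: "open S" and F: "F holomorphic_on S" "G holomorphic_on S"
    and f: "\<And>z. z \<in> S \<Longrightarrow> f z = F z + cnj (G z)"
  shows "C1_on S f"
    and "z \<in> S \<Longrightarrow> partial v f z = v * deriv F z + cnj (v * deriv G z)"
proof -
  have D: "((\<lambda>t. f (z + t *\<^sub>R v)) has_vector_derivative v * deriv F z + cnj (v * deriv G z)) (at 0)"
    if z: "z \<in> S" for z v
  proof -
    have *: "((\<lambda>t::real. H (z + t *\<^sub>R v)) has_vector_derivative v * deriv H z) (at 0)"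
      if "H holomorphic_on S" for H
    proof -
      have "(H has_field_derivative deriv H z) (at (z + (0::real) *\<^sub>R v))"
        using holomorphic_derivI[OF that S z] by simp
      moreover have "((\<lambda>t::real. z + t *\<^sub>R v) has_vector_derivative v) (at 0)"
        by (auto intro!: derivative_eq_intros)
      ultimately show ?thesis
        using field_vector_diff_chain_at[of "\<lambda>t::real. z + t *\<^sub>R v" v 0 H "deriv H z"] by (simp add: o_def)
    qed
    have "((\<lambda>t. F (z + t *\<^sub>R v) + cnj (G (z + t *\<^sub>R v))) has_vector_derivative v * deriv F z + cnj (v * deriv G z)) (at 0)"
      by (intro has_vector_derivative_add has_vector_derivative_cnj * F)
    moreover have "open ((\<lambda>t. z + t *\<^sub>R v) -` S)"
      by (rule open_vimage[OF S]) (intro continuous_intros)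
    ultimately show ?thesis
      by (rule has_vector_derivative_transform_within_open) (use z f in auto)
  qed
  show P: "partial v f z = v * deriv F z + cnj (v * deriv G z)" if "z \<in> S" for v z
    by (rule partial_eqI[OF D[OF that]])
  have "continuous_on S (\<lambda>z. v * deriv F z + cnj (v * deriv G z))" for v
    by (intro continuous_intros holomorphic_on_imp_continuous_on holomorphic_deriv F S)
  then have "continuous_on S (partial v f)" for v
    using P by (simp cong: continuous_on_cong)
  then show "C1_on S f"
    unfolding C1_on_def using D by (auto intro: differentiableI_vector)
qed

text \<open>A partial derivative in direction \<open>v\<close> is again holomorphic plus
  conjugate-holomorphic, with parts \<open>v * deriv F\<close> and \<open>v * deriv G\<close>. Two
  differentiations produce the factor \<open>v\<^sup>2\<close>, and 1 and
  \<open>\<i>\<^sup>2\<close> cancel in the Laplacian.\<close>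

lemma harmonic_on_holomorphic_plus_cnj:
  fixes f :: "complex \<Rightarrow> complex"
  assumes S: "open S" and F: "F holomorphic_on S" "G holomorphic_on S"
    and f: "\<And>z. z \<in> S \<Longrightarrow> f z = F z + cnj (G z)"
  shows "harmonic_on S f"
proof -
  have h: "(\<lambda>z. v * deriv F z) holomorphic_on S" "(\<lambda>z. v * deriv G z) holomorphic_on S" for v
    by (intro holomorphic_intros F S)+
  have P: "partial v f z = v * deriv F z + cnj (v * deriv G z)" if "z \<in> S" for v z
    using C1_on_holomorphic_plus_cnj(2)[OF S F f that] .
  have Q: "C1_on S (partial v f)"
      "z \<in> S \<Longrightarrow> partial w (partial v f) z = w * deriv (\<lambda>z. v * deriv F z) z + cnj (w * deriv (\<lambda>z. v * deriv G z) z)" for v w z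
    using C1_on_holomorphic_plus_cnj[OF S h P] by blast+
  have "laplacian f z = 0" if "z \<in> S" for z
  proof -
    have "deriv (\<lambda>z. v * deriv H z) z = v * deriv (deriv H) z" if "H holomorphic_on S" for v H
      using holomorphic_derivI[OF holomorphic_deriv[OF that S] S \<open>z \<in> S\<close>]
      by (auto intro!: DERIV_imp_deriv derivative_eq_intros)
    then show ?thesis
      using that F by (simp add: laplacian_def Basis_complex_def Q(2))
  qed
  then show ?thesis
    using S Q(1) C1_on_holomorphic_plus_cnj(1)[OF S F f] unfolding harmonic_on_def C2_on_def by auto
qed

text \<open>The Cauchy-Riemann equation turns the real-linear total derivative into multiplication
  by the complex number \<open>partial 1 f z\<close>.\<close>

lemma Cauchy_Riemann_imp_holomorphic:
  assumes C1: "C1_on S f" and S: "open S"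
    and CR: "\<And>z. z \<in> S \<Longrightarrow> partial \<i> f z = \<i> * partial 1 f z"
  shows "f holomorphic_on S" and "z \<in> S \<Longrightarrow> deriv f z = partial 1 f z"
proof -
  have D: "(f has_field_derivative partial 1 f z) (at z)" if "z \<in> S" for z
  proof -
    have "(\<lambda>w. Re w *\<^sub>R partial 1 f z + Im w *\<^sub>R partial \<i> f z) = (\<lambda>w. partial 1 f z * w)"
      by (rule ext, subst CR[OF that]) (auto simp: complex_eq_iff algebra_simps)
    then show ?thesis
      using C1_on_has_derivative[OF C1 S that] by (simp add: has_field_derivative_def)
  qed
  then show "f holomorphic_on S" "z \<in> S \<Longrightarrow> deriv f z = partial 1 f z"
    using S by (auto simp: holomorphic_on_open intro: DERIV_imp_deriv)
qed

lemma C1_on_cmult_add: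
  fixes f g :: "complex \<Rightarrow> complex"
  assumes "C1_on S f" "C1_on S g"
  shows "C1_on S (\<lambda>z. f z + c * g z)"
    and "z \<in> S \<Longrightarrow> v \<in> Basis \<Longrightarrow> partial v (\<lambda>z. f z + c * g z) z = partial v f z + c * partial v g z"
proof -
  have D: "((\<lambda>t. f (z + t *\<^sub>R v) + c * g (z + t *\<^sub>R v)) has_vector_derivative partial v f z + c * partial v g z) (at 0)"
    if "z \<in> S" "v \<in> Basis" for z v
    using has_vector_derivative_partial[OF assms(1) that(2), of z 0]
      has_vector_derivative_partial[OF assms(2) that(2), of z 0] that
    by (auto intro!: derivative_eq_intros)
  then show P: "z \<in> S \<Longrightarrow> v \<in> Basis \<Longrightarrow> partial v (\<lambda>z. f z + c * g z) z = partial v f z + c * partial v g z" for z v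
    by (intro partial_eqI)
  show "C1_on S (\<lambda>z. f z + c * g z)"
    unfolding C1_on_def
  proof (intro ballI conjI)
    fix v :: complex assume v: "v \<in> Basis"
    show "(\<lambda>t. f (z + t *\<^sub>R v) + c * g (z + t *\<^sub>R v)) differentiable at 0" if "z \<in> S" for z
      using D[OF that v] by (rule differentiableI_vector)
    have "continuous_on S (\<lambda>z. partial v f z + c * partial v g z)"
      using assms v unfolding C1_on_def by (intro continuous_intros) auto
    then show "continuous_on S (partial v (\<lambda>z. f z + c * g z))"
      using P v by (simp cong: continuous_on_cong)
  qed
qed

lemma C1_on_cnj:
  fixes f :: "complex \<Rightarrow> complex"
  assumes "C1_on S f"
  shows "C1_on S (\<lambda>z. cnj (f z))"
    and "z \<in> S \<Longrightarrow> v \<in> Basis \<Longrightarrow> partial v (\<lambda>z. cnj (f z)) z = cnj (partial v f z)"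
proof -
  have D: "((\<lambda>t. cnj (f (z + t *\<^sub>R v))) has_vector_derivative cnj (partial v f z)) (at 0)"
    if "z \<in> S" "v \<in> Basis" for z v
    using has_vector_derivative_partial[OF assms that(2), of z 0] that
    by (auto intro!: has_vector_derivative_cnj)
  then show P: "z \<in> S \<Longrightarrow> v \<in> Basis \<Longrightarrow> partial v (\<lambda>z. cnj (f z)) z = cnj (partial v f z)" for z v
    by (intro partial_eqI)
  show "C1_on S (\<lambda>z. cnj (f z))"
    unfolding C1_on_def
  proof (intro ballI conjI)
    fix v :: complex assume v: "v \<in> Basis"
    show "(\<lambda>t. cnj (f (z + t *\<^sub>R v))) differentiable at 0" if "z \<in> S" for z
      using D[OF that v] by (rule differentiableI_vector)
    have "continuous_on S (\<lambda>z. cnj (partial v f z))"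
      using assms v unfolding C1_on_def by (intro continuous_intros) auto
    then show "continuous_on S (partial v (\<lambda>z. cnj (f z)))"
      using P v by (simp cong: continuous_on_cong)
  qed
qed

text \<open>\<open>\<phi>\<close> is twice the Wirtinger derivative of \<open>f\<close> in
  \<open>z\<close>; the Laplace equation and the symmetry of mixed partials are its Cauchy-Riemann
  equation. Convexity provides a primitive \<open>F\<close> of half of \<open>\<phi>\<close>. The
  remainder \<open>g = f - F\<close> has Wirtinger derivative 0 in \<open>z\<close>, so its
  conjugate is holomorphic.\<close>

lemma harmonic_on_imp_holomorphic_plus_cnj:
  fixes f :: "complex \<Rightarrow> complex"
  assumes h: "harmonic_on S f" and S: "convex S"
  obtains F G where "F holomorphic_on S" "G holomorphic_on S" "\<And>z. z \<in> S \<Longrightarrow> f z = F z + cnj (G z)"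
proof -
  have op: "open S" and C2: "C2_on S f" and lap: "\<And>z. z \<in> S \<Longrightarrow> laplacian f z = 0"
    using h unfolding harmonic_on_def by auto
  have B: "(1::complex) \<in> Basis" "\<i> \<in> Basis" by (auto simp: Basis_complex_def)
  have C1: "C1_on S f" "C1_on S (partial 1 f)" "C1_on S (partial \<i> f)"
    using C2 B unfolding C2_on_def by auto
  define \<phi> where "\<phi> = (\<lambda>z. partial 1 f z + (-\<i>) * partial \<i> f z)"
  note \<phi> = C1_on_cmult_add[OF C1(2,3), where c = "-\<i>", folded \<phi>_def]
  have "partial \<i> \<phi> z = \<i> * partial 1 \<phi> z" if "z \<in> S" for z
    using lap[OF that] C2_on_mixed_partials[OF C2 op that] that
    by (simp add: \<phi>(2) B laplacian_def Basis_complex_def algebra_simps add_eq_0_iff)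
  then have "\<phi> holomorphic_on S"
    by (rule Cauchy_Riemann_imp_holomorphic[OF \<phi>(1) op])
  then have "(\<lambda>z. \<phi> z / 2) holomorphic_on S"
    by (intro holomorphic_intros) auto
  then obtain F where F: "\<And>z. z \<in> S \<Longrightarrow> (F has_field_derivative \<phi> z / 2) (at z within S)"
    using holomorphic_convex_primitive'[OF S op] by metis
  have holF: "F holomorphic_on S" using F by (auto simp: holomorphic_on_def field_differentiable_def)
  have dF: "deriv F z = \<phi> z / 2" if "z \<in> S" for z
    using F[OF that] unfolding at_within_open[OF that op] by (rule DERIV_imp_deriv)
  note PF = C1_on_holomorphic_plus_cnj[OF op holF holomorphic_on_const[of 0], of F, simplified]
  define g where "g = (\<lambda>z. f z + (-1) * F z)"
  note g = C1_on_cmult_add[OF C1(1) PF(1), where c = "-1", folded g_def]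
  note cg = C1_on_cnj[OF g(1)]
  have "partial \<i> (\<lambda>z. cnj (g z)) z = \<i> * partial 1 (\<lambda>z. cnj (g z)) z" if "z \<in> S" for z
    using that B by (simp add: cg(2) g(2) PF(2) dF \<phi>_def field_simps)
  then have "(\<lambda>z. cnj (g z)) holomorphic_on S"
    by (rule Cauchy_Riemann_imp_holomorphic[OF cg(1) op])
  from that[OF holF this] show ?thesis by (simp add: g_def)
qed

subsection \<open>Zero sets and first-order optimality\<close>

text \<open>Off the critical points, \<open>F\<close> has local holomorphic inverses, so the zero
  set of \<open>Re F\<close> is locally a smooth image of a piece of the imaginary axis. The
  critical points are countable unless \<open>F\<close> is constant, in which case
  \<open>Re F\<close> has no zero at all.\<close>

lemma negligible_zeros_Re_holomorphic:
  assumes F: "F holomorphic_on S" and S: "open S" "connected S"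
    and w: "w \<in> S" "Re (F w) \<noteq> 0"
  shows "negligible {z \<in> S. Re (F z) = 0}"
proof (cases "deriv F constant_on S \<and> deriv F w = 0")
  case True
  then have "deriv F z = 0" if "z \<in> S" for z
    using w that by (metis constant_on_def)
  then have "(F has_field_derivative 0) (at z)" if "z \<in> S" for z
    using holomorphic_derivI[OF F S(1) that] that by simp
  then have "F constant_on S"
    by (rule has_field_derivative_0_imp_constant_on[OF _ S(2,1)])
  then have "{z \<in> S. Re (F z) = 0} = {}"
    using w by (force simp: constant_on_def)
  then show ?thesis by (metis negligible_empty)
next
  case False
  define Z where "Z = {z \<in> S. deriv F z = 0}"
  define N where "N = {z \<in> S - Z. Re (F z) = 0}"
  have hol: "deriv F holomorphic_on S" by (rule holomorphic_deriv[OF F S(1)])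
  obtain C :: "nat \<Rightarrow> complex set" where "\<And>n. compact (C n)" "\<Union>(range C) = S"
    using open_Union_compact_subsets[OF S(1)] by metis
  then have "fsigma S"
    unfolding fsigma_Union_compact by (intro exI[of _ C]) auto
  have "countable Z"
  proof (cases "deriv F constant_on S")
    case True
    then have "Z = {}" using False w by (force simp: Z_def constant_on_def)
    then show ?thesis by simp
  next
    case False
    then show ?thesis
      unfolding Z_def using hol S \<open>fsigma S\<close> by (intro holomorphic_countable_zeros) auto
  qed
  then have Z: "negligible Z" by (simp add: countable_imp_null_set_lborel negligible_iff_null_sets null_sets_completionI)
  \<comment> \<open>It is enough to cover \<open>N\<close> by relatively open null pieces.\<close>
  have "\<exists>U. openin (top_of_set N) U \<and> x \<in> U \<and> negligible U" if "x \<in> N" for x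
  proof -
    have x: "x \<in> S" "deriv F x \<noteq> 0" using that by (auto simp: N_def Z_def)
    obtain r where r: "r > 0" "ball x r \<subseteq> S" "inj_on F (ball x r)"
      using has_complex_derivative_locally_injective[OF F x(1) S(1) x(2)] .
    have FB: "F holomorphic_on ball x r" by (rule holomorphic_on_subset[OF F r(2)])
    obtain g where g: "g holomorphic_on (F ` ball x r)" "\<And>z. z \<in> ball x r \<Longrightarrow> g (F z) = z"
      using holomorphic_has_inverse[OF FB open_ball r(3)] by metis
    have "negligible {w::complex. 1 \<bullet> w = 0}"
      by (rule negligible_hyperplane) auto
    then have neg: "negligible {w. Re w = 0}" by (simp add: inner_complex_def)
    have opF: "open (F ` ball x r)"
      by (rule open_mapping_thm3[OF FB open_ball r(3)])
    have "g differentiable_on (F ` ball x r \<inter> {w. Re w = 0})"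
      using g(1) opF
      by (auto intro!: differentiable_on_subset[OF holomorphic_on_imp_differentiable_on])
    then have "negligible (g ` (F ` ball x r \<inter> {w. Re w = 0}))"
      by (intro negligible_differentiable_image_negligible negligible_subset[OF neg]) auto
    moreover have "N \<inter> ball x r \<subseteq> g ` (F ` ball x r \<inter> {w. Re w = 0})"
      using g(2) by (force simp: N_def image_iff)
    ultimately have "negligible (N \<inter> ball x r)" by (rule negligible_subset)
    then show ?thesis
      using that r(1) by (intro exI[of _ "N \<inter> ball x r"]) auto
  qed
  then have "negligible N" by (subst locally_negligible_alt) blast
  with Z have "negligible (Z \<union> N)" by (rule negligible_Un)
  then show ?thesis by (rule negligible_subset) (auto simp: N_def)
qed

text \<open>The set where two continuous functions differ is open, and a nonempty open set is not
  null.\<close>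

lemma AE_eq_imp_eq_on_open:
  fixes f g :: "'a::euclidean_space \<Rightarrow> 'b::real_normed_vector"
  assumes S: "open S" and f: "continuous_on S f" "continuous_on S g"
    and ae: "AE x in lebesgue_on S. f x = g x" and x: "x \<in> S"
  shows "f x = g x"
proof -
  have meas: "S \<in> sets lebesgue" using S by simp
  define N where "N = S \<inter> (\<lambda>x. f x - g x) -` (- {0})"
  have "open N" unfolding N_def
    by (rule continuous_open_preimage) (use S f in \<open>auto intro: continuous_intros\<close>)
  moreover have "AE x in lebesgue. x \<notin> N"
    using ae meas by (subst (asm) AE_restrict_space_iff) (auto simp: N_def elim: AE_mp)
  then have "negligible N"
    using \<open>open N\<close> by (simp add: negligible_iff_null_sets AE_iff_null_sets[symmetric])
  ultimately have "N = {}" using open_not_negligible by blast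
  then show ?thesis using x by (auto simp: N_def)
qed

lemma AE_lebesgue_on_notin_negligible:
  assumes "negligible N" "S \<in> sets lebesgue"
  shows "AE x in lebesgue_on S. x \<notin> N"
proof -
  have "AE x in lebesgue. x \<notin> N" using assms by (simp add: negligible_iff_null_sets AE_not_in)
  then show ?thesis using assms by (auto simp: AE_restrict_space_iff)
qed

text \<open>The integral is the one-sided derivative of \<open>t \<mapsto> \<integral>\<bar>f + t g\<bar>\<close> at \<open>0\<close>.\<close>

lemma integral_sgn_mult_nonneg:
  fixes f g :: "'a \<Rightarrow> real"
  assumes f: "integrable M f" and g: "integrable M g" and ae: "AE x in M. f x \<noteq> 0"
    and min: "\<And>t. t > 0 \<Longrightarrow> (\<integral>x. \<bar>f x\<bar> \<partial>M) \<le> (\<integral>x. \<bar>f x + t * g x\<bar> \<partial>M)"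
  shows "0 \<le> (\<integral>x. sgn (f x) * g x \<partial>M)"
proof -
  define t where "t = (\<lambda>n. 1 / real (Suc n))"
  define q where "q = (\<lambda>n x. (\<bar>f x + t n * g x\<bar> - \<bar>f x\<bar>) / t n)"
  have t: "t n > 0" for n by (simp add: t_def)
  have t0: "t \<longlonglongrightarrow> 0" unfolding t_def by (rule LIMSEQ_Suc[OF lim_1_over_n])
  have [measurable]: "f \<in> borel_measurable M" "g \<in> borel_measurable M" using f g by auto
  have "(\<lambda>n. \<integral>x. q n x \<partial>M) \<longlonglongrightarrow> (\<integral>x. sgn (f x) * g x \<partial>M)"
  proof (rule integral_dominated_convergence)
    show "integrable M (\<lambda>x. \<bar>g x\<bar>)" using g by simp
    show "AE x in M. (\<lambda>n. q n x) \<longlonglongrightarrow> sgn (f x) * g x"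
    proof (rule AE_mp[OF ae], rule AE_I2, rule impI)
      fix x assume nz: "f x \<noteq> 0"
      have "(\<lambda>n. \<bar>t n * g x\<bar>) \<longlonglongrightarrow> \<bar>0 * g x\<bar>" by (intro tendsto_intros t0)
      then have "\<forall>\<^sub>F n in sequentially. \<bar>t n * g x\<bar> < \<bar>f x\<bar>"
        by (rule order_tendstoD(2)) (use nz in simp)
      \<comment> \<open>Once the perturbation is smaller than \<open>\<bar>f x\<bar>\<close>, it no
        longer changes the sign, and the difference quotient equals its limit exactly.\<close>
      then have "\<forall>\<^sub>F n in sequentially. sgn (f x) * g x = q n x"
      proof eventually_elim
        case (elim n)
        then have "\<bar>f x + t n * g x\<bar> - \<bar>f x\<bar> = sgn (f x) * (t n * g x)"
          using nz by (auto simp: sgn_if abs_if split: if_splits)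
        then show ?case using t[of n] by (simp add: q_def field_simps)
      qed
      then show "(\<lambda>n. q n x) \<longlonglongrightarrow> sgn (f x) * g x"
        by (rule Lim_transform_eventually[rotated]) simp
    qed
    show "AE x in M. norm (q n x) \<le> \<bar>g x\<bar>" for n
    proof (rule AE_I2)
      fix x
      have "\<bar>\<bar>f x + t n * g x\<bar> - \<bar>f x\<bar>\<bar> \<le> t n * \<bar>g x\<bar>"
        using abs_triangle_ineq3[of "f x + t n * g x" "f x"] t[of n] by (simp add: abs_mult)
      then show "norm (q n x) \<le> \<bar>g x\<bar>" using t[of n] by (simp add: q_def field_simps)
    qed
  qed (auto simp: q_def)
  moreover have "0 \<le> (\<integral>x. q n x \<partial>M)" for n
    using min[OF t[of n]] t[of n] f g by (simp add: q_def)
  ultimately show ?thesis using LIMSEQ_le_const by blast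
qed

text \<open>The one-sided derivatives in the directions \<open>g\<close> and \<open>- g\<close> are
  both nonnegative and are negatives of each other.\<close>

lemma integral_sgn_mult_eq_0:
  fixes f g :: "'a \<Rightarrow> real"
  assumes f: "integrable M f" and g: "integrable M g" and ae: "AE x in M. f x \<noteq> 0"
    and min: "\<And>t. (\<integral>x. \<bar>f x\<bar> \<partial>M) \<le> (\<integral>x. \<bar>f x + t * g x\<bar> \<partial>M)"
  shows "(\<integral>x. sgn (f x) * g x \<partial>M) = 0"
proof (rule antisym)
  show "0 \<le> (\<integral>x. sgn (f x) * g x \<partial>M)"
    by (rule integral_sgn_mult_nonneg[OF f g ae min])
  have "0 \<le> (\<integral>x. sgn (f x) * - g x \<partial>M)"
    by (rule integral_sgn_mult_nonneg[OF f _ ae]) (use g min[of "- t" for t] in auto)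
  then show "(\<integral>x. sgn (f x) * g x \<partial>M) \<le> 0" by simp
qed

subsection \<open>The Cauchy transform of a bounded density\<close>

lemma ball_measurable [measurable]: "ball (z::'a::metric_space) e \<in> sets borel"
  by simp

text \<open>Dyadic annuli: at distance between \<open>e / 2 ^ Suc k\<close> and
  \<open>e / 2 ^ k\<close> the integrand is at most \<open>2 ^ Suc k / e\<close>, and the
  surrounding disk has area \<open>pi * e\<^sup>2 / 4 ^ k\<close>. The geometric series sums to
  \<open>4 * pi * e\<close>. The centre contributes nothing, since \<open>1 / 0 = 0\<close>.\<close>

lemma nn_integral_inverse_dist_ball:
  fixes z :: complex
  assumes e: "e > 0"
  shows "(\<integral>\<^sup>+\<zeta>. ennreal (1 / norm (z - \<zeta>)) * indicator (ball z e) \<zeta> \<partial>lborel) \<le> ennreal (4 * pi * e)"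
proof -
  have pt: "ennreal (1 / norm (z - \<zeta>)) * indicator (ball z e) \<zeta>
      \<le> (\<Sum>k. ennreal (2 ^ Suc k / e) * indicator (ball z (e / 2 ^ k)) \<zeta>)" for \<zeta>
  proof (cases "\<zeta> \<in> ball z e \<and> \<zeta> \<noteq> z")
    case True
    define r where "r = norm (z - \<zeta>)"
    have r: "0 < r" "r < e" using True by (auto simp: r_def dist_norm)
    have "\<exists>k. e / 2 ^ Suc k \<le> r"
    proof -
      obtain k where "(1 / 2) ^ k < r / e"
        using real_arch_pow_inv[of "r / e" "1 / 2"] r e by auto
      then have "e / 2 ^ k < r" using e by (simp add: field_simps power_divide)
      moreover have "e / 2 ^ Suc k \<le> e / 2 ^ k" using e by (simp add: field_simps)
      ultimately show ?thesis by (intro exI[of _ k]) simp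
    qed
    \<comment> \<open>The least such \<open>k\<close> selects the annulus containing
      \<open>\<zeta>\<close>: minimality gives the upper bound on \<open>r\<close>, and for
      \<open>k = 0\<close> that bound is \<open>r < e\<close>.\<close>
    define k where "k = (LEAST k. e / 2 ^ Suc k \<le> r)"
    have k: "e / 2 ^ Suc k \<le> r"
      unfolding k_def using \<open>\<exists>k. _ k\<close> by (rule LeastI_ex)
    have "r < e / 2 ^ k"
    proof (cases k)
      case (Suc j)
      then have "\<not> e / 2 ^ Suc j \<le> r" unfolding k_def by (intro not_less_Least) simp
      then show ?thesis using Suc by simp
    qed (use r in simp)
    then have "indicator (ball z (e / 2 ^ k)) \<zeta> = (1::ennreal)" by (simp add: r_def dist_norm)
    moreover have "1 / r \<le> 2 ^ Suc k / e" using k r e by (simp add: field_simps)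
    ultimately have "ennreal (1 / norm (z - \<zeta>)) * indicator (ball z e) \<zeta>
        \<le> ennreal (2 ^ Suc k / e) * indicator (ball z (e / 2 ^ k)) \<zeta>"
      using True by (simp add: r_def ennreal_leI del: power_Suc)
    also have "\<dots> = (\<Sum>k\<in>{k}. ennreal (2 ^ Suc k / e) * indicator (ball z (e / 2 ^ k)) \<zeta>)"
      by (simp only: sum.insert_if finite.emptyI sum.empty empty_iff if_False add_0_right)
    also have "\<dots> \<le> (\<Sum>k. ennreal (2 ^ Suc k / e) * indicator (ball z (e / 2 ^ k)) \<zeta>)"
      by (rule sum_le_suminf) auto
    finally show ?thesis .
  qed auto
  have "(\<integral>\<^sup>+\<zeta>. ennreal (1 / norm (z - \<zeta>)) * indicator (ball z e) \<zeta> \<partial>lborel)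
      \<le> (\<integral>\<^sup>+\<zeta>. (\<Sum>k. ennreal (2 ^ Suc k / e) * indicator (ball z (e / 2 ^ k)) \<zeta>) \<partial>lborel)"
    by (intro nn_integral_mono pt)
  also have "\<dots> = (\<Sum>k. ennreal (2 ^ Suc k / e) * emeasure lborel (ball z (e / 2 ^ k)))"
    by (subst nn_integral_suminf, measurable) (simp add: nn_integral_cmult_indicator del: power_Suc)
  also have "\<dots> = (\<Sum>k. ennreal (2 * pi * e * (1 / 2) ^ k))"
  proof (rule suminf_cong)
    fix k :: nat
    have "2 ^ Suc k / e * (pi * (e / 2 ^ k)\<^sup>2) = 2 * pi * e * (1 / 2) ^ k"
      using e by (simp add: field_simps power2_eq_square)
    then show "ennreal (2 ^ Suc k / e) * emeasure lborel (ball z (e / 2 ^ k)) = ennreal (2 * pi * e * (1 / 2) ^ k)"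
      using e by (subst emeasure_ball) (simp_all add: unit_ball_vol_2 ennreal_mult[symmetric] del: power_Suc)
  qed
  also have "\<dots> = ennreal (4 * pi * e)"
  proof (rule suminf_ennreal_eq)
    have "(\<lambda>k. 2 * pi * e * (1 / 2) ^ k) sums (2 * pi * e * (1 / (1 - 1 / 2)))"
      by (intro sums_mult geometric_sums) simp
    then show "(\<lambda>k. 2 * pi * e * (1 / 2) ^ k) sums (4 * pi * e)" by (simp add: mult.assoc)
  qed (use e in auto)
  finally show ?thesis .
qed

text \<open>For \<open>e = 0\<close> this is the Cauchy kernel \<open>1/w\<close> (with junk value \<open>0\<close> at \<open>w = 0\<close>); for \<open>e > 0\<close>
  it is Lipschitz and its derivative with respect to \<open>cnj w\<close> is \<open>1/e\<^sup>2\<close> times the indicator of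
  the disk of radius \<open>e\<close>. Hence the \<open>cnj\<close>-derivative of the regularised transform is \<open>pi\<close> times
  the mean of the density over a disk, which is constant where the density is.\<close>

definition cauchy_kernel :: "real \<Rightarrow> complex \<Rightarrow> complex"
  where "cauchy_kernel e w = (if norm w < e then cnj w / of_real (e\<^sup>2) else 1 / w)"

text \<open>Inside the disk \<open>norm w * norm w \<le> e\<^sup>2\<close>. At \<open>w = 0\<close>
  both sides are 0 because \<open>1 / 0 = 0\<close>.\<close>

lemma norm_cauchy_kernel_le:
  assumes "e \<ge> 0"
  shows "norm (cauchy_kernel e w) \<le> 1 / norm w"
proof (cases "norm w < e \<and> w \<noteq> 0")
  case True
  then have "norm w * norm w \<le> e * e" using assms by (intro mult_mono) auto
  moreover have "e > 0" using True norm_ge_zero le_less_trans by blast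
  ultimately show ?thesis
    using True by (simp add: cauchy_kernel_def norm_divide norm_mult power2_eq_square field_simps)
qed (auto simp: cauchy_kernel_def norm_divide)

text \<open>The kernels agree outside the disk of radius \<open>e\<close>. Inside it, away from 0,
  their difference is \<open>1 / w\<close> times the real factor
  \<open>(norm w)\<^sup>2 / e\<^sup>2 - 1\<close>, which lies between -1 and 0.\<close>

lemma norm_cauchy_kernel_diff_le:
  assumes "e > 0"
  shows "norm (cauchy_kernel e w - cauchy_kernel 0 w) \<le> 1 / norm w * indicator (ball 0 e) w"
proof (cases "norm w < e \<and> w \<noteq> 0")
  case True
  have "(norm w)\<^sup>2 / e\<^sup>2 \<le> 1" using True power_mono[of "norm w" e 2] assms by (simp add: divide_le_eq)
  have "cauchy_kernel e w - cauchy_kernel 0 w = of_real ((norm w)\<^sup>2 / e\<^sup>2 - 1) / w"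
    using True assms unfolding of_real_diff of_real_divide complex_norm_square
    by (simp add: cauchy_kernel_def field_simps)
  then show ?thesis
    using True \<open>(norm w)\<^sup>2 / e\<^sup>2 \<le> 1\<close> by (simp add: norm_divide divide_right_mono del: of_real_diff of_real_divide)
qed (use assms in \<open>auto simp: cauchy_kernel_def\<close>)

text \<open>Two points on the same side of the circle of radius \<open>e\<close> cost
  \<open>1 / e\<^sup>2\<close>. In the mixed case, writing \<open>1 / b\<close> as
  \<open>cnj b / (norm b)\<^sup>2\<close> and exchanging the denominator for
  \<open>e\<^sup>2\<close> costs another \<open>2 / e\<^sup>2\<close>, because
  \<open>norm b - e \<le> norm (a - b)\<close>.\<close>

lemma cauchy_kernel_Lipschitz:
  assumes e: "e > 0"
  shows "norm (cauchy_kernel e a - cauchy_kernel e b) \<le> 3 / e\<^sup>2 * norm (a - b)"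
proof -
  have mixed: "norm (cauchy_kernel e a - cauchy_kernel e b) \<le> 3 / e\<^sup>2 * norm (a - b)"
    if a: "norm a < e" and b: "e \<le> norm b" for a b
  proof -
    have b0: "norm b > 0" using b e by linarith
    have eq: "1 / b = cnj b / of_real ((norm b)\<^sup>2)"
      using b0 unfolding complex_norm_square by (simp add: field_simps)
    have "cauchy_kernel e a - cauchy_kernel e b
        = cnj (a - b) / of_real (e\<^sup>2) + cnj b * of_real (1 / e\<^sup>2 - 1 / (norm b)\<^sup>2)"
      using a b by (simp add: cauchy_kernel_def eq diff_divide_distrib algebra_simps)
    also have "norm \<dots> \<le> norm (a - b) / e\<^sup>2 + norm b * \<bar>1 / e\<^sup>2 - 1 / (norm b)\<^sup>2\<bar>"
      by (rule order_trans[OF norm_triangle_ineq])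
        (simp add: norm_divide norm_mult norm_power del: of_real_diff of_real_divide complex_cnj_diff)
    also have "norm b * \<bar>1 / e\<^sup>2 - 1 / (norm b)\<^sup>2\<bar> = (norm b - e) * (norm b + e) / (e\<^sup>2 * norm b)"
    proof -
      have "1 / (norm b)\<^sup>2 \<le> 1 / e\<^sup>2" using b b0 e by (intro divide_left_mono power_mono mult_pos_pos zero_less_power) auto
      then show ?thesis using b0 e by (simp add: field_simps power2_eq_square)
    qed
    also have "\<dots> \<le> (norm b - e) * (2 * norm b) / (e\<^sup>2 * norm b)"
      using b b0 e by (intro divide_right_mono mult_left_mono) auto
    also have "\<dots> = 2 / e\<^sup>2 * (norm b - e)" using b0 by simp
    also have "\<dots> \<le> 2 / e\<^sup>2 * norm (a - b)"
      using a norm_triangle_ineq3[of b a] by (intro mult_left_mono) (auto simp: norm_minus_commute)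
    finally show ?thesis by (simp add: field_simps)
  qed
  have outer: "norm (cauchy_kernel e a - cauchy_kernel e b) \<le> 3 / e\<^sup>2 * norm (a - b)"
    if a: "e \<le> norm a" and b: "e \<le> norm b"
  proof -
    have "a \<noteq> 0" "b \<noteq> 0" using a b e by auto
    then have "norm (cauchy_kernel e a - cauchy_kernel e b) = norm (a - b) / (norm a * norm b)"
      using a b by (simp add: cauchy_kernel_def norm_divide norm_mult diff_frac_eq norm_minus_commute)
    also have "\<dots> \<le> norm (a - b) / (e * e)"
      using a b e \<open>a \<noteq> 0\<close> \<open>b \<noteq> 0\<close> by (intro divide_left_mono mult_mono mult_pos_pos) auto
    also have "\<dots> \<le> 3 / e\<^sup>2 * norm (a - b)"
      using e by (simp add: field_simps power2_eq_square)
    finally show ?thesis .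
  qed
  have inner: "norm (cauchy_kernel e a - cauchy_kernel e b) \<le> 3 / e\<^sup>2 * norm (a - b)"
    if "norm a < e" "norm b < e"
  proof -
    have "cauchy_kernel e a - cauchy_kernel e b = cnj (a - b) / of_real (e\<^sup>2)"
      using that by (simp add: cauchy_kernel_def diff_divide_distrib)
    then have "norm (cauchy_kernel e a - cauchy_kernel e b) = norm (a - b) / e\<^sup>2"
      by (simp only: norm_divide norm_of_real complex_mod_cnj) simp
    then show ?thesis using e by (simp add: field_simps)
  qed
  consider "norm a < e" "norm b < e" | "norm a < e" "e \<le> norm b" | "e \<le> norm a" "norm b < e" | "e \<le> norm a" "e \<le> norm b"
    by linarith
  then show ?thesis
    using mixed[of a b] mixed[of b a] inner outer by cases (auto simp: norm_minus_commute)
qed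

lemma measurable_cauchy_kernel [measurable]: "cauchy_kernel e \<in> borel_measurable borel"
  unfolding cauchy_kernel_def
proof (rule measurable_If)
  show "(\<lambda>w. cnj w / of_real (e\<^sup>2)) \<in> borel_measurable borel"
    by (cases "e = 0") (auto intro!: borel_measurable_continuous_onI continuous_intros)
  show "(\<lambda>w::complex. 1 / w) \<in> borel_measurable borel"
    by (intro borel_measurable_divide borel_measurable_const measurable_ident) simp
  have "{w \<in> space borel. norm w < e} = ball 0 e" by auto
  then show "{w \<in> space borel. norm w < e} \<in> sets borel" by simp
qed

lemma has_field_derivative_cauchy_kernel:
  assumes "norm w > e" "e \<ge> 0"
  shows "(cauchy_kernel e has_field_derivative - 1 / w\<^sup>2) (at w)"
proof (rule has_field_derivative_transform_within_open)
  have "w \<noteq> 0" using assms by auto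
  then show "((\<lambda>w. 1 / w) has_field_derivative - 1 / w\<^sup>2) (at w)"
    by (auto intro!: derivative_eq_intros simp: power2_eq_square)
  show "open {w::complex. norm w > e}" by (intro open_Collect_less continuous_intros)
qed (use assms in \<open>auto simp: cauchy_kernel_def\<close>)

text \<open>Lebesgue measure is taken without the factor \<open>1 / pi\<close>; hence the factor
  \<open>pi\<close> in front of \<open>cnj z\<close> where the density is constant.\<close>

definition cauchy_transform :: "complex set \<Rightarrow> (complex \<Rightarrow> complex) \<Rightarrow> real \<Rightarrow> complex \<Rightarrow> complex"
  where "cauchy_transform S \<sigma> e z = (\<integral>\<zeta>. \<sigma> \<zeta> * cauchy_kernel e (z - \<zeta>) \<partial>lebesgue_on S)"

context
  fixes S :: "complex set" and \<sigma> :: "complex \<Rightarrow> complex"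
  assumes S: "S \<in> lmeasurable"
    and \<sigma>_measurable [measurable]: "\<sigma> \<in> borel_measurable (lebesgue_on S)"
    and \<sigma>_le: "\<And>\<zeta>. norm (\<sigma> \<zeta>) \<le> 1"
begin

lemma S_sets: "S \<in> sets lebesgue" using S by (simp add: fmeasurableD)

lemma finite_measure_lebesgue_on_S: "finite_measure (lebesgue_on S)"
  by (rule finite_measure_lebesgue_on[OF S])

lemma measurable_lebesgue_on_S:
  "f \<in> borel_measurable borel \<Longrightarrow> f \<in> borel_measurable (lebesgue_on S)"
  by (intro measurable_restrict_space1 borel_measurable_if_lebesgue_on measurable_completion) simp

lemma measurable_kernel [measurable]: "(\<lambda>\<zeta>. cauchy_kernel e (z - \<zeta>)) \<in> borel_measurable (lebesgue_on S)"
  by (rule measurable_lebesgue_on_S) measurable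

lemma nn_integral_inverse_dist_le:
  assumes "e > 0"
  shows "(\<integral>\<^sup>+\<zeta>. ennreal (1 / norm (z - \<zeta>) * indicator (ball z e) \<zeta>) \<partial>lebesgue_on S) \<le> ennreal (4 * pi * e)"
proof -
  have "(\<integral>\<^sup>+\<zeta>. ennreal (1 / norm (z - \<zeta>) * indicator (ball z e) \<zeta>) \<partial>lebesgue_on S)
      = (\<integral>\<^sup>+\<zeta>. ennreal (1 / norm (z - \<zeta>) * indicator (ball z e) \<zeta>) * indicator S \<zeta> \<partial>lebesgue)"
    using S_sets by (subst nn_integral_restrict_space) auto
  also have "\<dots> \<le> (\<integral>\<^sup>+\<zeta>. ennreal (1 / norm (z - \<zeta>)) * indicator (ball z e) \<zeta> \<partial>lebesgue)"
    by (intro nn_integral_mono) (auto split: split_indicator)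
  also have "\<dots> = (\<integral>\<^sup>+\<zeta>. ennreal (1 / norm (z - \<zeta>)) * indicator (ball z e) \<zeta> \<partial>lborel)"
    by (rule nn_integral_completion) measurable
  finally show ?thesis using nn_integral_inverse_dist_ball[OF assms, of z] by (rule order_trans)
qed

text \<open>Within distance 1 of \<open>z\<close> the dyadic estimate applies; farther away the
  integrand is at most 1 and the measure is finite.\<close>

lemma integrable_inverse_dist: "integrable (lebesgue_on S) (\<lambda>\<zeta>. 1 / norm (z - \<zeta>))"
proof (rule integrableI_bounded)
  interpret finite_measure "lebesgue_on S" by (rule finite_measure_lebesgue_on_S)
  have m: "(\<lambda>\<zeta>. 1 / norm (z - \<zeta>) * indicator (ball z 1) \<zeta>) \<in> borel_measurable (lebesgue_on S)"
    by (rule measurable_lebesgue_on_S) measurable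
  show "(\<lambda>\<zeta>. 1 / norm (z - \<zeta>)) \<in> borel_measurable (lebesgue_on S)"
    by (rule measurable_lebesgue_on_S) measurable
  have "(\<integral>\<^sup>+\<zeta>. norm (1 / norm (z - \<zeta>)) \<partial>lebesgue_on S)
      \<le> (\<integral>\<^sup>+\<zeta>. ennreal (1 / norm (z - \<zeta>) * indicator (ball z 1) \<zeta>) + 1 \<partial>lebesgue_on S)"
  proof (intro nn_integral_mono)
    fix \<zeta>
    have "1 / norm (z - \<zeta>) \<le> 1" if "\<zeta> \<notin> ball z 1"
      using that by (simp add: dist_norm divide_le_eq)
    then show "ennreal (norm (1 / norm (z - \<zeta>))) \<le> ennreal (1 / norm (z - \<zeta>) * indicator (ball z 1) \<zeta>) + 1"
      by (cases "\<zeta> \<in> ball z 1") auto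
  qed
  also have "\<dots> = (\<integral>\<^sup>+\<zeta>. ennreal (1 / norm (z - \<zeta>) * indicator (ball z 1) \<zeta>) \<partial>lebesgue_on S)
      + emeasure (lebesgue_on S) (space (lebesgue_on S))"
    using m by (subst nn_integral_add) auto
  also have "\<dots> \<le> ennreal (4 * pi * 1) + emeasure (lebesgue_on S) (space (lebesgue_on S))"
    by (intro add_right_mono nn_integral_inverse_dist_le) simp
  also have "\<dots> < \<infinity>" by (simp add: less_top[symmetric])
  finally show "(\<integral>\<^sup>+\<zeta>. norm (1 / norm (z - \<zeta>)) \<partial>lebesgue_on S) < \<infinity>" .
qed

lemma integrable_cauchy:
  assumes "e \<ge> 0"
  shows "integrable (lebesgue_on S) (\<lambda>\<zeta>. \<sigma> \<zeta> * cauchy_kernel e (z - \<zeta>))"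
proof (rule Bochner_Integration.integrable_bound[OF integrable_inverse_dist[of z]])
  show "AE \<zeta> in lebesgue_on S. norm (\<sigma> \<zeta> * cauchy_kernel e (z - \<zeta>)) \<le> norm (1 / norm (z - \<zeta>))"
    using mult_mono[OF \<sigma>_le norm_cauchy_kernel_le[OF assms]] by (auto simp: norm_mult)
qed measurable

text \<open>The kernels differ only on the disk of radius \<open>e\<close> about \<open>z\<close>,
  by at most the inverse distance. The bound does not depend on \<open>z\<close>, which makes the
  convergence uniform.\<close>

lemma cauchy_transform_approx:
  assumes e: "e > 0"
  shows "norm (cauchy_transform S \<sigma> e z - cauchy_transform S \<sigma> 0 z) \<le> 4 * pi * e"
proof -
  have i: "integrable (lebesgue_on S) (\<lambda>\<zeta>. \<sigma> \<zeta> * cauchy_kernel e (z - \<zeta>) - \<sigma> \<zeta> * cauchy_kernel 0 (z - \<zeta>))"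
    using e by (intro Bochner_Integration.integrable_diff integrable_cauchy) auto
  have "cauchy_transform S \<sigma> e z - cauchy_transform S \<sigma> 0 z
      = (\<integral>\<zeta>. \<sigma> \<zeta> * cauchy_kernel e (z - \<zeta>) - \<sigma> \<zeta> * cauchy_kernel 0 (z - \<zeta>) \<partial>lebesgue_on S)"
    unfolding cauchy_transform_def
    using e by (intro Bochner_Integration.integral_diff[symmetric] integrable_cauchy) auto
  then have "ennreal (norm (cauchy_transform S \<sigma> e z - cauchy_transform S \<sigma> 0 z))
      \<le> (\<integral>\<^sup>+\<zeta>. norm (\<sigma> \<zeta> * cauchy_kernel e (z - \<zeta>) - \<sigma> \<zeta> * cauchy_kernel 0 (z - \<zeta>)) \<partial>lebesgue_on S)"
    using integral_norm_bound_ennreal[OF i] by simp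
  also have "\<dots> \<le> (\<integral>\<^sup>+\<zeta>. ennreal (1 / norm (z - \<zeta>) * indicator (ball z e) \<zeta>) \<partial>lebesgue_on S)"
  proof (intro nn_integral_mono ennreal_leI)
    fix \<zeta>
    have "norm (\<sigma> \<zeta> * cauchy_kernel e (z - \<zeta>) - \<sigma> \<zeta> * cauchy_kernel 0 (z - \<zeta>))
        \<le> 1 * (1 / norm (z - \<zeta>) * indicator (ball 0 e) (z - \<zeta>))"
      unfolding right_diff_distrib[symmetric] norm_mult
      by (intro mult_mono \<sigma>_le norm_cauchy_kernel_diff_le e) auto
    also have "indicator (ball 0 e) (z - \<zeta>) = (indicator (ball z e) \<zeta> :: real)"
      by (auto simp: indicator_def dist_norm norm_minus_commute)
    finally show "norm (\<sigma> \<zeta> * cauchy_kernel e (z - \<zeta>) - \<sigma> \<zeta> * cauchy_kernel 0 (z - \<zeta>))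
        \<le> 1 / norm (z - \<zeta>) * indicator (ball z e) \<zeta>" by simp
  qed
  also have "\<dots> \<le> ennreal (4 * pi * e)" by (rule nn_integral_inverse_dist_le[OF e])
  finally show ?thesis using e by (subst (asm) ennreal_le_iff) auto
qed

lemma cauchy_transform_uniform_limit:
  assumes "e \<longlonglongrightarrow> 0" "\<And>n. e n > 0"
  shows "uniform_limit A (\<lambda>n. cauchy_transform S \<sigma> (e n)) (cauchy_transform S \<sigma> 0) sequentially"
proof (rule uniform_limitI)
  fix d :: real assume "d > 0"
  have "(\<lambda>n. 4 * pi * e n) \<longlonglongrightarrow> 4 * pi * 0" by (intro tendsto_intros assms)
  then have "\<forall>\<^sub>F n in sequentially. 4 * pi * e n < d"
    by (rule order_tendstoD(2)) (use \<open>d > 0\<close> in simp)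
  then show "\<forall>\<^sub>F n in sequentially. \<forall>z\<in>A. dist (cauchy_transform S \<sigma> (e n) z) (cauchy_transform S \<sigma> 0 z) < d"
    by eventually_elim (auto simp: dist_norm intro: le_less_trans[OF cauchy_transform_approx[OF assms(2)]])
qed

lemma cauchy_transform_continuous_regular:
  assumes e: "e > 0"
  shows "continuous_on A (cauchy_transform S \<sigma> e)"
proof (rule continuous_on_subset[OF lipschitz_on_continuous_on])
  interpret finite_measure "lebesgue_on S" by (rule finite_measure_lebesgue_on_S)
  define L where "L = 3 / e\<^sup>2 * measure (lebesgue_on S) (space (lebesgue_on S))"
  show "L-lipschitz_on UNIV (cauchy_transform S \<sigma> e)"
  proof (rule lipschitz_onI)
    fix z z'
    have "cauchy_transform S \<sigma> e z - cauchy_transform S \<sigma> e z'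
      = (\<integral>\<zeta>. \<sigma> \<zeta> * cauchy_kernel e (z - \<zeta>) - \<sigma> \<zeta> * cauchy_kernel e (z' - \<zeta>) \<partial>lebesgue_on S)"
      unfolding cauchy_transform_def
      using e by (intro Bochner_Integration.integral_diff[symmetric] integrable_cauchy) auto
    also have "norm \<dots> \<le> (\<integral>\<zeta>. 3 / e\<^sup>2 * norm (z - z') \<partial>lebesgue_on S)"
    proof (rule Bochner_Integration.integral_norm_bound_integral)
      show "integrable (lebesgue_on S) (\<lambda>\<zeta>. \<sigma> \<zeta> * cauchy_kernel e (z - \<zeta>) - \<sigma> \<zeta> * cauchy_kernel e (z' - \<zeta>))"
        using e by (intro Bochner_Integration.integrable_diff integrable_cauchy) auto
      fix \<zeta>
      have "norm (\<sigma> \<zeta> * cauchy_kernel e (z - \<zeta>) - \<sigma> \<zeta> * cauchy_kernel e (z' - \<zeta>))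
          \<le> 1 * (3 / e\<^sup>2 * norm ((z - \<zeta>) - (z' - \<zeta>)))"
        unfolding right_diff_distrib[symmetric] norm_mult
        by (intro mult_mono \<sigma>_le cauchy_kernel_Lipschitz e) auto
      then show "norm (\<sigma> \<zeta> * cauchy_kernel e (z - \<zeta>) - \<sigma> \<zeta> * cauchy_kernel e (z' - \<zeta>)) \<le> 3 / e\<^sup>2 * norm (z - z')"
        by simp
    qed simp
    finally show "dist (cauchy_transform S \<sigma> e z) (cauchy_transform S \<sigma> e z') \<le> L * dist z z'"
      by (simp add: dist_norm L_def mult_ac)
  qed (simp add: L_def)
qed simp

lemma cauchy_transform_continuous: "continuous_on A (cauchy_transform S \<sigma> 0)"
proof (rule uniform_limit_theorem[OF _ cauchy_transform_uniform_limit])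
  show "(\<lambda>n. 1 / real (Suc n)) \<longlonglongrightarrow> 0" by (rule LIMSEQ_Suc[OF lim_1_over_n])
  show "\<forall>\<^sub>F n in sequentially. continuous_on A (cauchy_transform S \<sigma> (1 / real (Suc n)))"
    by (intro always_eventually allI cauchy_transform_continuous_regular) simp
qed simp_all

text \<open>Inside the disk the kernel is antilinear, and its increments integrate to
  \<open>pi * c * cnj h\<close> because the disk has area \<open>pi * e\<^sup>2\<close>. Subtracting
  this leaves only the holomorphic part of the kernel; dominated convergence passes to the
  limit.\<close>

lemma cauchy_transform_regular_has_derivative:
  assumes e: "e > 0" and B: "ball z e \<subseteq> S" and c: "\<And>\<zeta>. \<zeta> \<in> ball z e \<Longrightarrow> \<sigma> \<zeta> = c"
  shows "((\<lambda>z. cauchy_transform S \<sigma> e z - of_real pi * c * cnj z) has_field_derivative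
    (\<integral>\<zeta>. \<sigma> \<zeta> * (if norm (z - \<zeta>) > e then - 1 / (z - \<zeta>)\<^sup>2 else 0) \<partial>lebesgue_on S)) (at z)"
    (is "(?E has_field_derivative (\<integral>\<zeta>. ?D \<zeta> \<partial>_)) _")
  unfolding DERIV_def tendsto_at_iff_sequentially
proof (intro allI impI)
  interpret finite_measure "lebesgue_on S" by (rule finite_measure_lebesgue_on_S)
  fix h :: "nat \<Rightarrow> complex" assume "\<forall>i. h i \<in> UNIV - {0}" and h: "h \<longlonglongrightarrow> 0"
  then have h0: "h n \<noteq> 0" for n by auto
  \<comment> \<open>The antilinear increment is removed inside the integrand, so that the quotients
    converge pointwise: inside the disk they are eventually 0, outside they tend to the derivative
    of \<open>1 / w\<close>.\<close>
  define q where "q = (\<lambda>n \<zeta>. \<sigma> \<zeta> * (cauchy_kernel e (z + h n - \<zeta>) - cauchy_kernel e (z - \<zeta>)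
      - cnj (h n) / of_real (e\<^sup>2) * indicator (ball z e) \<zeta>) / h n)"
  have mball [measurable]: "(indicator (ball z e) :: complex \<Rightarrow> complex) \<in> borel_measurable (lebesgue_on S)"
    by (rule measurable_lebesgue_on_S) measurable
  have mD: "?D \<in> borel_measurable (lebesgue_on S)"
    by (intro borel_measurable_times \<sigma>_measurable measurable_lebesgue_on_S) measurable
  have ind: "(\<integral>\<zeta>. \<sigma> \<zeta> * indicator (ball z e) \<zeta> \<partial>lebesgue_on S) = c * of_real (pi * e\<^sup>2)"
  proof -
    have "(\<integral>\<zeta>. \<sigma> \<zeta> * indicator (ball z e) \<zeta> \<partial>lebesgue_on S) = (\<integral>\<zeta>. c * indicator (ball z e) \<zeta> \<partial>lebesgue_on S)"
      using c by (intro Bochner_Integration.integral_cong) (auto simp: indicator_def)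
    also have "\<dots> = c * (\<integral>\<zeta>. indicator (ball z e) \<zeta> \<partial>lebesgue_on S)" by simp
    also have "(\<integral>\<zeta>. indicator (ball z e) \<zeta> \<partial>lebesgue_on S) = (\<integral>\<zeta>. complex_of_real (indicator (ball z e) \<zeta>) \<partial>lebesgue_on S)"
      by (intro Bochner_Integration.integral_cong) (auto simp: indicator_def)
    also have "\<dots> = of_real (\<integral>\<zeta>. indicator (ball z e) \<zeta> \<partial>lebesgue_on S)"
      by (rule integral_complex_of_real)
    also have "(\<integral>\<zeta>. indicator (ball z e) \<zeta> \<partial>lebesgue_on S) = measure (lebesgue_on S) (ball z e)"
      using B by (simp add: Int_absorb2)
    also have "measure (lebesgue_on S) (ball z e) = measure lebesgue (ball z e)"
      using B S_sets by (intro measure_restrict_space) auto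
    also have "\<dots> = pi * e\<^sup>2" using e by (simp add: content_ball unit_ball_vol_2)
    finally show ?thesis .
  qed
  have int_ind: "integrable (lebesgue_on S) (\<lambda>\<zeta>. \<sigma> \<zeta> * indicator (ball z e) \<zeta>)"
  proof (rule integrable_const_bound[where B = 1])
    show "AE \<zeta> in lebesgue_on S. norm (\<sigma> \<zeta> * indicator (ball z e) \<zeta>) \<le> 1"
      using \<sigma>_le by (auto simp: norm_mult indicator_def)
  qed measurable
  have "(\<lambda>n. \<integral>\<zeta>. q n \<zeta> \<partial>lebesgue_on S) \<longlonglongrightarrow> (\<integral>\<zeta>. ?D \<zeta> \<partial>lebesgue_on S)"
  \<comment> \<open>The dominating constant adds the Lipschitz constant \<open>3 / e\<^sup>2\<close>
    and the bound \<open>1 / e\<^sup>2\<close> for the correction. The circle where the kernel has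
    its kink is null.\<close>
  proof (rule integral_dominated_convergence[where w = "\<lambda>_. 4 / e\<^sup>2"])
    have "AE \<zeta> in lebesgue. \<zeta> \<notin> sphere z e"
      using negligible_sphere[of z e] unfolding negligible_iff_null_sets by (rule AE_not_in)
    then have "AE \<zeta> in lebesgue_on S. \<zeta> \<notin> sphere z e"
      using S_sets by (subst AE_restrict_space_iff) auto
    then show "AE \<zeta> in lebesgue_on S. (\<lambda>n. q n \<zeta>) \<longlonglongrightarrow> ?D \<zeta>"
    proof eventually_elim
      case (elim \<zeta>)
      then consider "norm (z - \<zeta>) < e" | "norm (z - \<zeta>) > e" by (force simp: dist_norm)
      then show ?case
      proof cases
        case 1
        have "(\<lambda>n. norm (z + h n - \<zeta>)) \<longlonglongrightarrow> norm (z + 0 - \<zeta>)" by (intro tendsto_intros h)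
        then have "\<forall>\<^sub>F n in sequentially. norm (z + h n - \<zeta>) < e"
          by (rule order_tendstoD(2)) (use 1 in simp)
        then have "\<forall>\<^sub>F n in sequentially. ?D \<zeta> = q n \<zeta>"
          by eventually_elim (use 1 in \<open>simp add: q_def cauchy_kernel_def dist_norm add_divide_distrib diff_divide_distrib\<close>)
        then show ?thesis by (rule Lim_transform_eventually[rotated]) simp
      next
        case 2
        have "(cauchy_kernel e has_field_derivative - 1 / (z - \<zeta>)\<^sup>2) (at (z - \<zeta>))"
          by (rule has_field_derivative_cauchy_kernel) (use 2 e in auto)
        then have "((\<lambda>h. (cauchy_kernel e (z - \<zeta> + h) - cauchy_kernel e (z - \<zeta>)) / h) \<circ> h) \<longlonglongrightarrow> - 1 / (z - \<zeta>)\<^sup>2"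
          unfolding DERIV_def tendsto_at_iff_sequentially using h h0 by blast
        then have "(\<lambda>n. \<sigma> \<zeta> * ((cauchy_kernel e (z - \<zeta> + h n) - cauchy_kernel e (z - \<zeta>)) / h n)) \<longlonglongrightarrow> \<sigma> \<zeta> * (- 1 / (z - \<zeta>)\<^sup>2)"
          by (intro tendsto_mult tendsto_const) (simp add: o_def)
        moreover have "\<zeta> \<notin> ball z e" using 2 by (simp add: dist_norm)
        ultimately show ?thesis using 2 by (simp add: q_def algebra_simps)
      qed
    qed
    show "AE \<zeta> in lebesgue_on S. norm (q n \<zeta>) \<le> 4 / e\<^sup>2" for n
    proof (rule AE_I2)
      fix \<zeta>
      have "norm (cnj (h n) / of_real (e\<^sup>2) * indicator (ball z e) \<zeta>) \<le> norm (h n) / e\<^sup>2"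
        using e by (auto simp: norm_divide norm_mult norm_power indicator_def)
      moreover have "norm (cauchy_kernel e (z + h n - \<zeta>) - cauchy_kernel e (z - \<zeta>)) \<le> 3 / e\<^sup>2 * norm (h n)"
        using cauchy_kernel_Lipschitz[OF e, of "z + h n - \<zeta>" "z - \<zeta>"] by simp
      ultimately have "norm (cauchy_kernel e (z + h n - \<zeta>) - cauchy_kernel e (z - \<zeta>)
          - cnj (h n) / of_real (e\<^sup>2) * indicator (ball z e) \<zeta>) \<le> 3 / e\<^sup>2 * norm (h n) + norm (h n) / e\<^sup>2"
        by (intro order_trans[OF norm_triangle_ineq4 add_mono])
      also have "\<dots> = 4 / e\<^sup>2 * norm (h n)" by (simp add: field_simps)
      finally have "norm (\<sigma> \<zeta>) * norm (cauchy_kernel e (z + h n - \<zeta>) - cauchy_kernel e (z - \<zeta>)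
          - cnj (h n) / of_real (e\<^sup>2) * indicator (ball z e) \<zeta>) \<le> 1 * (4 / e\<^sup>2 * norm (h n))"
        by (intro mult_mono \<sigma>_le) auto
      then show "norm (q n \<zeta>) \<le> 4 / e\<^sup>2"
        using h0[of n] by (simp add: q_def norm_divide norm_mult pos_divide_le_eq)
    qed
    show "q n \<in> borel_measurable (lebesgue_on S)" for n unfolding q_def by measurable
  qed (use mD in auto)
  moreover have "(\<integral>\<zeta>. q n \<zeta> \<partial>lebesgue_on S) = (?E (z + h n) - ?E z) / h n" for n
  proof -
    have "q n = (\<lambda>\<zeta>. (\<sigma> \<zeta> * cauchy_kernel e (z + h n - \<zeta>) - \<sigma> \<zeta> * cauchy_kernel e (z - \<zeta>)
        - cnj (h n) / of_real (e\<^sup>2) * (\<sigma> \<zeta> * indicator (ball z e) \<zeta>)) / h n)"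
      by (auto simp: q_def algebra_simps)
    then have "(\<integral>\<zeta>. q n \<zeta> \<partial>lebesgue_on S) = (cauchy_transform S \<sigma> e (z + h n) - cauchy_transform S \<sigma> e z
        - cnj (h n) / of_real (e\<^sup>2) * (c * of_real (pi * e\<^sup>2))) / h n"
      using integrable_cauchy[of e] int_ind e by (simp add: cauchy_transform_def ind)
    then show ?thesis using e by (simp add: algebra_simps)
  qed
  ultimately show "((\<lambda>h. (?E (z + h) - ?E z) / h) \<circ> h) \<longlonglongrightarrow> (\<integral>\<zeta>. ?D \<zeta> \<partial>lebesgue_on S)"
    by (simp add: o_def)
qed

text \<open>A locally uniform limit of the holomorphic regularised versions. The halved radius
  leaves room for each averaging disk to stay where \<sigma> is constant.\<close>

lemma cauchy_transform_minus_cnj_holomorphic: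
  assumes r: "r > 0" and B: "ball z r \<subseteq> S" and c: "\<And>\<zeta>. \<zeta> \<in> ball z r \<Longrightarrow> \<sigma> \<zeta> = c"
  shows "(\<lambda>z. cauchy_transform S \<sigma> 0 z - of_real pi * c * cnj z) holomorphic_on ball z (r / 2)"
proof (rule holomorphic_uniform_sequence)
  define e where "e = (\<lambda>n. r / 2 * (1 / real (Suc n)))"
  have e: "e n > 0" "e n \<le> r / 2" for n using r by (auto simp: e_def field_simps)
  have "e \<longlonglongrightarrow> r / 2 * 0" unfolding e_def by (intro tendsto_intros LIMSEQ_Suc[OF lim_1_over_n])
  then have e0: "e \<longlonglongrightarrow> 0" by simp
  show "(\<lambda>z. cauchy_transform S \<sigma> (e n) z - of_real pi * c * cnj z) holomorphic_on ball z (r / 2)" for n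
  proof -
    have "ball w (e n) \<subseteq> ball z r" if "w \<in> ball z (r / 2)" for w
    proof
      fix x assume "x \<in> ball w (e n)"
      then show "x \<in> ball z r"
        using that e(2)[of n] dist_triangle[of z x w] by simp
    qed
    then show ?thesis
      unfolding holomorphic_on_open[OF open_ball]
      using cauchy_transform_regular_has_derivative[OF e(1)] B c by (meson subset_iff)
  qed
  show "\<exists>d>0. cball x d \<subseteq> ball z (r / 2) \<and> uniform_limit (cball x d)
      (\<lambda>n z. cauchy_transform S \<sigma> (e n) z - of_real pi * c * cnj z)
      (\<lambda>z. cauchy_transform S \<sigma> 0 z - of_real pi * c * cnj z) sequentially"
    if x: "x \<in> ball z (r / 2)" for x
  proof -
    obtain d where "d > 0" "cball x d \<subseteq> ball z (r / 2)"
      using x open_ball[of z "r / 2"] unfolding open_contains_cball by meson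
    moreover have "uniform_limit (cball x d) (\<lambda>n z. cauchy_transform S \<sigma> (e n) z - of_real pi * c * cnj z)
      (\<lambda>z. cauchy_transform S \<sigma> 0 z - of_real pi * c * cnj z) sequentially"
      by (rule uniform_limit_minus[OF cauchy_transform_uniform_limit[OF e0 e(1)] uniform_limit_const])
    ultimately show ?thesis by blast
  qed
qed simp

end

subsection \<open>Best harmonic approximants\<close>

text \<open>The scaling is recast as a density, the form to which \<open>integrable_density\<close>
  and \<open>integral_density\<close> apply.\<close>

lemma disk_area_eq_density: "disk_area = density (lebesgue_on unit_disk) (\<lambda>_. ennreal (1 / pi))"
  by (rule measure_eqI) (auto simp: disk_area_def emeasure_density_const)

lemma integrable_disk_area_iff:
  fixes f :: "complex \<Rightarrow> 'b::{banach, second_countable_topology}"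
  shows "integrable disk_area f \<longleftrightarrow> integrable (lebesgue_on unit_disk) f"
proof (cases "f \<in> borel_measurable (lebesgue_on unit_disk)")
  case True
  then show ?thesis
    unfolding disk_area_eq_density
    using integrable_scaleR_right[of pi "lebesgue_on unit_disk" "\<lambda>x. (1 / pi) *\<^sub>R f x"]
    by (subst integrable_density) auto
next
  case False
  then show ?thesis
    by (auto simp: disk_area_eq_density dest: borel_measurable_integrable)
qed

lemma L1_norm_eq_integral:
  assumes "integrable (lebesgue_on unit_disk) f"
  shows "L1_norm f = (\<integral>z. norm (f z) \<partial>lebesgue_on unit_disk) / pi"
  using assms unfolding L1_norm_def disk_area_eq_density
  by (subst integral_density) auto

text \<open>From here on, harmonicity is used only through the representation
  \<open>F z + cnj (G z)\<close>, available because the disk is convex.\<close>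

lemma L1_harmonic_iff:
  "h \<in> L1_harmonic \<longleftrightarrow> integrable (lebesgue_on unit_disk) h \<and>
    (\<exists>F G. F holomorphic_on unit_disk \<and> G holomorphic_on unit_disk \<and> (\<forall>z\<in>unit_disk. h z = F z + cnj (G z)))"
  unfolding L1_harmonic_def integrable_disk_area_iff mem_Collect_eq
  by (metis harmonic_on_imp_holomorphic_plus_cnj harmonic_on_holomorphic_plus_cnj convex_ball open_ball)

lemma L1_harmonic_integrable: "h \<in> L1_harmonic \<Longrightarrow> integrable (lebesgue_on unit_disk) h"
  by (simp add: L1_harmonic_iff)

lemma L1_harmonic_continuous_on:
  assumes "h \<in> L1_harmonic"
  shows "continuous_on unit_disk h"
proof -
  obtain F G where "F holomorphic_on unit_disk" "G holomorphic_on unit_disk"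
    and h: "\<And>z. z \<in> unit_disk \<Longrightarrow> h z = F z + cnj (G z)"
    using assms unfolding L1_harmonic_iff by blast
  then have "continuous_on unit_disk (\<lambda>z. F z + cnj (G z))"
    by (intro continuous_intros holomorphic_on_imp_continuous_on)
  then show ?thesis by (rule continuous_on_eq) (simp add: h)
qed

lemma holomorphic_in_L1_harmonic:
  assumes "F holomorphic_on unit_disk" "integrable (lebesgue_on unit_disk) F"
  shows "F \<in> L1_harmonic"
  using assms unfolding L1_harmonic_iff
  by (intro conjI exI[of _ F] exI[of _ "\<lambda>_. 0"]) auto

lemma L1_harmonic_lincomb:
  assumes "g \<in> L1_harmonic" "h \<in> L1_harmonic"
  shows "(\<lambda>z. a * g z + b * h z) \<in> L1_harmonic"
proof -
  obtain F G where g: "F holomorphic_on unit_disk" "G holomorphic_on unit_disk" "\<forall>z\<in>unit_disk. g z = F z + cnj (G z)"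
    using assms(1) unfolding L1_harmonic_iff by blast
  obtain F' G' where h: "F' holomorphic_on unit_disk" "G' holomorphic_on unit_disk" "\<forall>z\<in>unit_disk. h z = F' z + cnj (G' z)"
    using assms(2) unfolding L1_harmonic_iff by blast
  show ?thesis
    unfolding L1_harmonic_iff
  proof (intro conjI exI)
    show "integrable (lebesgue_on unit_disk) (\<lambda>z. a * g z + b * h z)"
      using assms[THEN L1_harmonic_integrable] by simp
    show "(\<lambda>z. a * F z + b * F' z) holomorphic_on unit_disk"
      "(\<lambda>z. cnj a * G z + cnj b * G' z) holomorphic_on unit_disk"
      by (intro holomorphic_intros g h)+
  qed (use g h in \<open>simp add: algebra_simps\<close>)
qed

text \<open>The real part of \<open>F + cnj G\<close> is that of \<open>F + G\<close>, so half of
  \<open>F + G\<close> serves for both the holomorphic and the conjugated part.\<close>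

lemma L1_harmonic_Re:
  assumes "h \<in> L1_harmonic"
  shows "(\<lambda>z. of_real (Re (h z))) \<in> L1_harmonic"
proof -
  obtain F G where h: "F holomorphic_on unit_disk" "G holomorphic_on unit_disk" "\<forall>z\<in>unit_disk. h z = F z + cnj (G z)"
    using assms unfolding L1_harmonic_iff by blast
  show ?thesis
    unfolding L1_harmonic_iff
  proof (intro conjI exI)
    show "integrable (lebesgue_on unit_disk) (\<lambda>z. complex_of_real (Re (h z)))"
      using assms[THEN L1_harmonic_integrable] by simp
    show hol: "(\<lambda>z. (F z + G z) / 2) holomorphic_on unit_disk"
      by (intro holomorphic_intros h) auto
    then show "(\<lambda>z. (F z + G z) / 2) holomorphic_on unit_disk" .
  qed (use h in \<open>simp add: complex_eq_iff field_simps\<close>)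
qed

section \<open>Optimality as an integral inequality, and realness of best approximants\<close>

lemma best_harmonic_approximant_le:
  assumes w: "integrable (lebesgue_on unit_disk) w" and h: "best_harmonic_approximant w h"
    and g: "g \<in> L1_harmonic"
  shows "(\<integral>z. norm (w z - h z) \<partial>lebesgue_on unit_disk) \<le> (\<integral>z. norm (w z - g z) \<partial>lebesgue_on unit_disk)"
proof -
  have hH: "h \<in> L1_harmonic" using h by (simp add: best_harmonic_approximant_def)
  have "bdd_below ((\<lambda>g. L1_norm (\<lambda>z. w z - g z)) ` L1_harmonic)"
    by (rule bdd_belowI[of _ 0]) (auto simp: L1_norm_def)
  then have "L1_norm (\<lambda>z. w z - h z) \<le> L1_norm (\<lambda>z. w z - g z)"
    using h g unfolding best_harmonic_approximant_def by (auto intro: cINF_lower)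
  then show ?thesis
    using w g hH L1_harmonic_integrable by (simp add: L1_norm_eq_integral divide_le_cancel)
qed

text \<open>The difference is nonnegative with integral 0, hence zero almost everywhere and, by
  continuity, everywhere. This turns equal norms into pointwise equalities.\<close>

lemma integral_le_imp_eq_on_open:
  fixes f g :: "'a::euclidean_space \<Rightarrow> real"
  assumes S: "open S" and cont: "continuous_on S f" "continuous_on S g"
    and int: "integrable (lebesgue_on S) f" "integrable (lebesgue_on S) g"
    and le: "\<And>x. x \<in> S \<Longrightarrow> f x \<le> g x"
    and ge: "(\<integral>x. g x \<partial>lebesgue_on S) \<le> (\<integral>x. f x \<partial>lebesgue_on S)"
    and x: "x \<in> S"
  shows "f x = g x"
\<comment> \<open>The nonnegative difference \<open>g - f\<close> is what gets integrated.\<close>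
proof -
  have nn: "AE x in lebesgue_on S. 0 \<le> g x - f x" using le by (intro AE_I2) auto
  have "(\<integral>x. g x - f x \<partial>lebesgue_on S) \<le> 0" using int ge by simp
  moreover have "0 \<le> (\<integral>x. g x - f x \<partial>lebesgue_on S)" using nn by (rule integral_nonneg_AE)
  ultimately have "(\<integral>x. g x - f x \<partial>lebesgue_on S) = 0" by simp
  then have "AE x in lebesgue_on S. g x - f x = 0"
    using int nn by (subst (asm) integral_nonneg_eq_0_iff_AE) auto
  then have "AE x in lebesgue_on S. f x = g x" by (rule AE_mp) (auto intro: AE_I2)
  then show ?thesis by (rule AE_eq_imp_eq_on_open[OF S cont _ x])
qed

text \<open>Passing from \<open>h\<close> to its real part never increases the pointwise error, so
  optimality forces equality of the moduli everywhere.\<close>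

lemma best_harmonic_approximant_real:
  fixes \<omega> :: "complex \<Rightarrow> real"
  assumes cont: "continuous_on unit_disk \<omega>" and int: "integrable (lebesgue_on unit_disk) \<omega>"
    and h: "best_harmonic_approximant (\<lambda>z. of_real (\<omega> z)) h" and z: "z \<in> unit_disk"
  shows "Im (h z) = 0"
proof -
  have hH: "h \<in> L1_harmonic" using h by (simp add: best_harmonic_approximant_def)
  note hi = L1_harmonic_integrable[OF hH] and hc = L1_harmonic_continuous_on[OF hH]
  have "norm (of_real (\<omega> z) - complex_of_real (Re (h z))) = norm (of_real (\<omega> z) - h z)"
  proof (rule integral_le_imp_eq_on_open[OF open_ball _ _ _ _ _ _ z])
    show "continuous_on unit_disk (\<lambda>z. norm (of_real (\<omega> z) - complex_of_real (Re (h z))))"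
      "continuous_on unit_disk (\<lambda>z. norm (of_real (\<omega> z) - h z))"
      by (intro continuous_intros cont hc)+
    show "integrable (lebesgue_on unit_disk) (\<lambda>z. norm (of_real (\<omega> z) - complex_of_real (Re (h z))))"
      "integrable (lebesgue_on unit_disk) (\<lambda>z. norm (of_real (\<omega> z) - h z))"
      using int hi by auto
    show "norm (of_real (\<omega> x) - complex_of_real (Re (h x))) \<le> norm (of_real (\<omega> x) - h x)" for x
      using abs_Re_le_cmod[of "of_real (\<omega> x) - h x"] by (simp flip: of_real_diff)
    show "(\<integral>z. norm (of_real (\<omega> z) - h z) \<partial>lebesgue_on unit_disk)
        \<le> (\<integral>z. norm (of_real (\<omega> z) - complex_of_real (Re (h z))) \<partial>lebesgue_on unit_disk)"
      by (rule best_harmonic_approximant_le[OF _ h L1_harmonic_Re[OF hH]]) (use int in simp)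
  qed
  then have "\<bar>Re (of_real (\<omega> z) - h z)\<bar> = norm (of_real (\<omega> z) - h z)"
    by (simp flip: of_real_diff)
  then have "(Re (of_real (\<omega> z) - h z))\<^sup>2 = (norm (of_real (\<omega> z) - h z))\<^sup>2"
    by (metis power2_abs)
  then show ?thesis by (simp add: cmod_power2)
qed

section \<open>Maximum principle with exponential weights, applied to the Cauchy transform\<close>

lemma eq_zero_if_exp_bounded:
  assumes x: "x > 0" and a: "a \<ge> 0" and le: "\<And>N::nat. a * exp (real N * x) \<le> C"
  shows "a = (0::real)"
proof (rule ccontr)
  assume "a \<noteq> 0"
  then have a: "a > 0" using a by simp
  obtain N :: nat where N: "C / a / x < real N" using reals_Archimedean2 by blast
  then have "C < a * (real N * x)" using a x by (simp add: field_simps)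
  also have "\<dots> \<le> a * exp (real N * x)"
    using a exp_ge_add_one_self[of "real N * x"] by (intro mult_left_mono) linarith+
  finally show False using le[of N] by simp
qed

text \<open>The boundedness of \<open>Re F\<close> enters only here: on the part of the boundary lying on the unit
  circle \<open>H\<close> is small while \<open>exp (N * F)\<close> stays bounded, and on the rest \<open>Re F = 0\<close>. Letting
  \<open>N \<rightarrow> \<infinity>\<close> gives \<open>H = 0\<close> wherever \<open>Re F > 0\<close>.\<close>

lemma maximum_principle_exp:
  assumes \<Omega>: "open \<Omega>" "\<Omega> \<subseteq> unit_disk" and H: "H holomorphic_on \<Omega>" "continuous_on (cball 0 1) H"
    and H0: "\<And>z. norm z = 1 \<Longrightarrow> H z = 0"
    and F: "F holomorphic_on unit_disk" and FM: "\<And>z. z \<in> unit_disk \<Longrightarrow> Re (F z) \<le> M"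
    and fr: "\<And>z. z \<in> closure \<Omega> \<Longrightarrow> z \<in> unit_disk \<Longrightarrow> z \<notin> \<Omega> \<Longrightarrow> Re (F z) \<le> 0"
    and w: "w \<in> \<Omega>" "Re (F w) > 0"
  shows "H w = 0"
proof -
  have "bounded (H ` cball 0 1)"
    by (intro compact_imp_bounded compact_continuous_image H compact_cball)
  then obtain C where C: "C > 0" "\<And>z. z \<in> cball 0 1 \<Longrightarrow> norm (H z) \<le> C"
    unfolding bounded_pos by auto
  \<comment> \<open>The bound \<open>C\<close> does not depend on \<open>N\<close>; this is what
    forces \<open>H w\<close> to vanish.\<close>
  have "norm (H w) * exp (real N * Re (F w)) \<le> C" for N
  proof -
    define E where "E = (\<lambda>z. H z * exp (of_nat N * F z))"
    \<comment> \<open>Chosen so that \<open>\<eta> * exp (real N * M) = C\<close>: smallness of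
      \<open>H\<close> near the circle pays for the growth of the exponential.\<close>
    define \<eta> where "\<eta> = C / exp (real N * M)"
    have \<eta>: "\<eta> > 0" using C by (simp add: \<eta>_def)
    have nE: "norm (E z) = norm (H z) * exp (real N * Re (F z))" for z
      by (simp add: E_def norm_mult)
    have "uniformly_continuous_on (cball 0 1) H"
      by (intro compact_uniformly_continuous H compact_cball)
    then obtain \<delta> where \<delta>: "\<delta> > 0"
      "\<And>z z'. z \<in> cball 0 1 \<Longrightarrow> z' \<in> cball 0 1 \<Longrightarrow> dist z' z < \<delta> \<Longrightarrow> dist (H z') (H z) < \<eta>"
      using \<eta> unfolding uniformly_continuous_on_def by meson
    have w1: "norm w < 1" using w \<Omega> by auto
    \<comment> \<open>The three terms put the circle of radius \<open>\<rho>\<close> within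
      \<open>\<delta>\<close> of the unit circle, keep \<open>w\<close> inside it, and allow
      division by \<open>\<rho>\<close>. Cutting there keeps the closure of \<open>S\<close> in the
      open disk, where \<open>F\<close> is defined.\<close>
    define \<rho> where "\<rho> = max (max (1 - \<delta> / 2) ((1 + norm w) / 2)) (1 / 2)"
    have \<rho>: "norm w < \<rho>" "\<rho> < 1" "0 < \<rho>" "1 - \<rho> < \<delta>"
      using w1 \<delta>(1) by (auto simp: \<rho>_def max_def field_simps)
    have small: "norm (H z) \<le> \<eta>" if z: "norm z = \<rho>" for z
    proof -
      have "z - z / of_real \<rho> = z * of_real (1 - 1 / \<rho>)" by (simp add: algebra_simps)
      then have "dist z (z / of_real \<rho>) = \<rho> * \<bar>1 - 1 / \<rho>\<bar>"
        using z by (simp only: dist_norm norm_mult norm_of_real)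
      also have "\<dots> = 1 - \<rho>" using \<rho> by (simp add: abs_if field_simps)
      finally have "dist z (z / of_real \<rho>) < \<delta>" using \<rho> by simp
      moreover have n1: "norm (z / of_real \<rho>) = 1" using z \<rho> by (simp add: norm_divide)
      ultimately have "dist (H z) (H (z / of_real \<rho>)) < \<eta>"
        using \<rho> z by (intro \<delta>(2)) auto
      then show ?thesis using H0[OF n1] by simp
    qed
    define S where "S = \<Omega> \<inter> ball 0 \<rho>"
    have clS: "closure S \<subseteq> closure \<Omega>" "closure S \<subseteq> cball 0 \<rho>"
      unfolding S_def by (rule closure_mono, simp) (rule closure_minimal, auto)
    have sub: "cball 0 \<rho> \<subseteq> unit_disk" "unit_disk \<subseteq> cball (0::complex) 1" using \<rho> by auto
    have opS: "open S" unfolding S_def using \<Omega> by auto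
    have "norm (E w) \<le> C"
    proof (rule maximum_modulus_frontier[where f = E])
      show "E holomorphic_on interior S"
        unfolding E_def interior_open[OF opS]
        by (intro holomorphic_intros holomorphic_on_subset[OF H(1)] holomorphic_on_subset[OF F])
          (use \<Omega> in \<open>auto simp: S_def\<close>)
      show "continuous_on (closure S) E"
        unfolding E_def
        by (intro continuous_intros continuous_on_subset[OF H(2)]
            continuous_on_subset[OF holomorphic_on_imp_continuous_on[OF F]]) (use clS sub in blast)+
      show "bounded S" unfolding S_def by (intro bounded_Int) auto
      show "norm (E z) \<le> C" if "z \<in> frontier S" for z
      proof -
        have z: "z \<in> closure S" "z \<notin> S" using that opS by (auto simp: frontier_def interior_open)
        then have zD: "z \<in> unit_disk" "norm z \<le> \<rho>" using clS sub by auto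
        show ?thesis
        proof (cases "norm z = \<rho>")
          case True
          have "exp (real N * Re (F z)) \<le> exp (real N * M)"
            using FM[OF zD(1)] by (simp add: mult_left_mono)
          then have "norm (E z) \<le> \<eta> * exp (real N * M)"
            unfolding nE using small[OF True] \<eta> by (intro mult_mono) auto
          then show ?thesis by (simp add: \<eta>_def)
        next
          case False
          then have "z \<notin> \<Omega>" using z zD by (auto simp: S_def)
          then have "Re (F z) \<le> 0" using fr clS z zD by blast
          then have "exp (real N * Re (F z)) \<le> 1" by (simp add: mult_nonneg_nonpos)
          then have "norm (E z) \<le> C * 1"
            unfolding nE using C(2)[of z] zD sub C(1) by (intro mult_mono) auto
          then show ?thesis by simp
        qed
      qed
      show "w \<in> S" using w \<rho> by (auto simp: S_def)
    qed
    then show ?thesis by (simp add: nE)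
  qed
  then have "norm (H w) = 0" by (intro eq_zero_if_exp_bounded[OF w(2)]) auto
  then show ?thesis by simp
qed

text \<open>The maximum principle is applied on the set \<open>\<Omega>\<close> where
  \<open>Re F\<close> and \<open>f\<close> both have their sign at \<open>w\<close>, with
  \<open>F\<close> multiplied by the sign \<open>t\<close>. There \<sigma> is the constant
  \<open>s\<close>, and on the boundary inside the disk \<open>Re F\<close> vanishes, since a zero
  of \<open>f\<close> is one of \<open>Re F\<close>.\<close>

lemma norm_cauchy_transform_sgn:
  fixes f :: "complex \<Rightarrow> real"
  defines "\<sigma> \<equiv> \<lambda>z. complex_of_real (sgn (f z))"
  assumes f: "continuous_on unit_disk f" and \<sigma>: "\<sigma> \<in> borel_measurable (lebesgue_on unit_disk)"
    and K0: "\<And>z. norm z = 1 \<Longrightarrow> cauchy_transform unit_disk \<sigma> 0 z = 0"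
    and F: "F holomorphic_on unit_disk" and FM: "\<And>z. z \<in> unit_disk \<Longrightarrow> \<bar>Re (F z)\<bar> \<le> M"
    and nz: "\<And>z. z \<in> unit_disk \<Longrightarrow> Re (F z) \<noteq> 0 \<Longrightarrow> f z \<noteq> 0"
    and w: "w \<in> unit_disk" "Re (F w) \<noteq> 0"
  shows "norm (w * cauchy_transform unit_disk \<sigma> 0 w) = pi * (1 - (norm w)\<^sup>2)"
proof -
  define s where "s = sgn (f w)"
  define t where "t = sgn (Re (F w))"
  define \<Omega> where "\<Omega> = {z \<in> unit_disk. 0 < t * Re (F z) \<and> 0 < s * f z}"
  define K where "K = cauchy_transform unit_disk \<sigma> 0"
  define H where "H = (\<lambda>z. z * K z - of_real (pi * s * ((norm z)\<^sup>2 - 1)))"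
  have s: "\<bar>s\<bar> = 1" "s * f w > 0" using nz[OF w] by (auto simp: s_def sgn_if)
  have t: "\<bar>t\<bar> = 1" "t * Re (F w) > 0" using w by (auto simp: t_def sgn_if)
  have D: "unit_disk \<in> lmeasurable" by simp
  have \<sigma>1: "norm (\<sigma> z) \<le> 1" for z by (simp add: \<sigma>_def sgn_if)
  note ct = cauchy_transform_continuous[OF D \<sigma> \<sigma>1, folded K_def]
    and ch = cauchy_transform_minus_cnj_holomorphic[OF D \<sigma> \<sigma>1, folded K_def]
  have cF: "continuous_on unit_disk (\<lambda>z. t * Re (F z))" "continuous_on unit_disk (\<lambda>z. s * f z)"
    by (intro continuous_intros holomorphic_on_imp_continuous_on F f)+
  have op: "open \<Omega>"
  proof -
    have "\<Omega> = (unit_disk \<inter> (\<lambda>z. t * Re (F z)) -` {0<..}) \<inter> (unit_disk \<inter> (\<lambda>z. s * f z) -` {0<..})"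
      by (auto simp: \<Omega>_def)
    then show ?thesis
      by (simp only:) (intro open_Int continuous_open_preimage cF open_ball open_greaterThan)
  qed
  have "H w = 0"
  proof (rule maximum_principle_exp[OF op, where H = H and F = "\<lambda>z. of_real t * F z" and M = M])
    show "\<Omega> \<subseteq> unit_disk" by (auto simp: \<Omega>_def)
    show "H holomorphic_on \<Omega>"
      unfolding holomorphic_on_def
    proof
      fix z assume "z \<in> \<Omega>"
      then obtain r where r: "r > 0" "ball z r \<subseteq> \<Omega>" using op openE by blast
      have c: "\<sigma> \<zeta> = of_real s" if "\<zeta> \<in> ball z r" for \<zeta>
      proof -
        have "s * f \<zeta> > 0" using r that by (auto simp: \<Omega>_def)
        then have "sgn (f \<zeta>) = s" using s(1) by (auto simp: sgn_if abs_if zero_less_mult_iff split: if_splits)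
        then show ?thesis by (simp add: \<sigma>_def)
      qed
      have "ball z r \<subseteq> unit_disk" using r by (auto simp: \<Omega>_def)
      then have "(\<lambda>z. K z - of_real pi * of_real s * cnj z) holomorphic_on ball z (r / 2)"
        by (rule ch[OF r(1)]) (rule c)
      \<comment> \<open>Multiplication by \<open>z\<close> turns \<open>cnj z\<close> into
        \<open>(norm z)\<^sup>2\<close>, which is constant on the unit circle; adding
        \<open>pi * s\<close> then makes the function vanish there along with
        \<open>K\<close>.\<close>
      then have "(\<lambda>z. z * (K z - of_real pi * of_real s * cnj z) + of_real (pi * s)) holomorphic_on ball z (r / 2)"
        by (intro holomorphic_on_add holomorphic_on_mult holomorphic_on_ident holomorphic_on_const)
      moreover have "z * (K z - of_real pi * of_real s * cnj z) + of_real (pi * s) = H z" for z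
        unfolding H_def of_real_mult of_real_diff complex_norm_square by (simp add: algebra_simps)
      ultimately have "H holomorphic_on ball z (r / 2)" by simp
      then have "H field_differentiable at z"
        using r by (intro holomorphic_on_imp_differentiable_at[OF _ open_ball]) auto
      then show "H field_differentiable at z within \<Omega>" by (rule field_differentiable_at_within)
    qed
    show "continuous_on (cball 0 1) H"
      unfolding H_def by (intro continuous_intros ct)
    show "H z = 0" if "norm z = 1" for z
      using K0[OF that] that by (simp add: H_def K_def)
    show "(\<lambda>z. of_real t * F z) holomorphic_on unit_disk" by (intro holomorphic_intros F)
    show "Re (of_real t * F z) \<le> M" if "z \<in> unit_disk" for z
      using FM[OF that] t(1) by (auto simp: abs_if split: if_splits)
    show "w \<in> \<Omega>" "0 < Re (of_real t * F w)" using w s t by (auto simp: \<Omega>_def)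
    show "Re (of_real t * F z) \<le> 0" if z: "z \<in> closure \<Omega>" "z \<in> unit_disk" "z \<notin> \<Omega>" for z
    proof -
      have lim: "0 \<le> g z" if g: "continuous_on unit_disk g" "\<And>x. x \<in> \<Omega> \<Longrightarrow> 0 < g x" for g :: "complex \<Rightarrow> real"
      proof (rule ccontr)
        assume "\<not> 0 \<le> g z"
        then have "z \<in> unit_disk \<inter> g -` {..<0}" using z by auto
        moreover have "open (unit_disk \<inter> g -` {..<0})"
          by (intro continuous_open_preimage g open_ball open_lessThan)
        ultimately have "\<Omega> \<inter> (unit_disk \<inter> g -` {..<0}) \<noteq> {}"
          using z(1) by (meson closure_iff_nhds_not_empty order_refl)
        then show False using g(2) by force
      qed
      have "0 \<le> t * Re (F z)" "0 \<le> s * f z"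
        by (auto intro!: lim cF simp: \<Omega>_def)
      moreover have "f z \<noteq> 0" if "Re (F z) \<noteq> 0" using nz z that by blast
      ultimately have "Re (F z) = 0"
        using z s(1) t(1) by (force simp: \<Omega>_def less_le)
      then show ?thesis by simp
    qed
  qed
  then have "w * K w = of_real (pi * s * ((norm w)\<^sup>2 - 1))" by (simp add: H_def)
  then have "norm (w * K w) = pi * \<bar>s\<bar> * \<bar>(norm w)\<^sup>2 - 1\<bar>"
    by (simp only: norm_of_real abs_mult) simp
  moreover have "(norm w)\<^sup>2 \<le> 1" using w by (intro power_le_one) auto
  ultimately show ?thesis by (simp add: s K_def)
qed

theorem theorem3p6:
  fixes \<omega> :: "complex \<Rightarrow> real" and h1 h2 :: "complex \<Rightarrow> complex"
  assumes "continuous_on unit_disk \<omega>"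
    and "integrable disk_area \<omega>"
    and "best_harmonic_approximant (\<lambda>z. complex_of_real (\<omega> z)) h1"
    and "best_harmonic_approximant (\<lambda>z. complex_of_real (\<omega> z)) h2"
    and "bounded ((\<lambda>z. h1 z - h2 z) ` unit_disk)"
  shows "\<forall>z\<in>unit_disk. h1 z = h2 z"
proof (rule ccontr)
  assume "\<not> (\<forall>z\<in>unit_disk. h1 z = h2 z)"
  then obtain w where w: "w \<in> unit_disk" "h1 w \<noteq> h2 w" by auto
  let ?D = "lebesgue_on unit_disk"
  have int: "integrable ?D \<omega>" using assms(2) by (simp add: integrable_disk_area_iff)
  then have intc: "integrable ?D (\<lambda>z. complex_of_real (\<omega> z))" by simp
  have H: "h1 \<in> L1_harmonic" "h2 \<in> L1_harmonic"
    using assms(3,4) by (auto simp: best_harmonic_approximant_def)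
  have real: "Im (h1 z) = 0" "Im (h2 z) = 0" if "z \<in> unit_disk" for z
    using best_harmonic_approximant_real[OF assms(1) int _ that] assms(3,4) by auto
  note le1 = best_harmonic_approximant_le[OF intc assms(3)]
    and le2 = best_harmonic_approximant_le[OF intc assms(4)]
  note hi = H[THEN L1_harmonic_integrable] and hc = H[THEN L1_harmonic_continuous_on]

  obtain F1 G1 where FG: "F1 holomorphic_on unit_disk" "G1 holomorphic_on unit_disk"
    "\<forall>z\<in>unit_disk. 1 * h1 z + (-1) * h2 z = F1 z + cnj (G1 z)"
    using L1_harmonic_lincomb[OF H, of 1 "-1"] unfolding L1_harmonic_iff by blast
  \<comment> \<open>As \<open>h1 - h2\<close> is real, it equals the real part of
    \<open>F1 + cnj G1\<close>, which is that of \<open>F1 + G1\<close>.\<close>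
  define F where "F = (\<lambda>z. F1 z + G1 z)"
  have F: "F holomorphic_on unit_disk" unfolding F_def by (intro holomorphic_intros FG)
  have hF: "h1 z - h2 z = of_real (Re (F z))" if "z \<in> unit_disk" for z
    using FG(3) real that by (auto simp: complex_eq_iff F_def)
  obtain M where M: "\<forall>z\<in>unit_disk. norm (h1 z - h2 z) \<le> M"
    using assms(5) unfolding bounded_iff ball_simps by (rule exE)
  have FM: "\<bar>Re (F z)\<bar> \<le> M" if "z \<in> unit_disk" for z
    using bspec[OF M that] unfolding hF[OF that] by simp
  define N where "N = {z \<in> unit_disk. Re (F z) = 0}"
  have N: "negligible N"
    unfolding N_def using hF[OF w(1)] w
    by (intro negligible_zeros_Re_holomorphic[OF F open_ball convex_connected[OF convex_ball] w(1)]) auto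

  \<comment> \<open>\<open>a\<close>, \<open>b\<close> and \<open>f\<close> are the errors of
    \<open>h1\<close>, \<open>h2\<close> and their midpoint.\<close>
  define a where "a = (\<lambda>z. \<omega> z - Re (h1 z))"
  define b where "b = (\<lambda>z. \<omega> z - Re (h2 z))"
  define f where "f = (\<lambda>z. (a z + b z) / 2)"
  have ab_int: "integrable ?D a" "integrable ?D b" "integrable ?D f"
    unfolding a_def b_def f_def using int hi by auto
  have ab_cont: "continuous_on unit_disk a" "continuous_on unit_disk b" "continuous_on unit_disk f"
    unfolding a_def b_def f_def by (intro continuous_intros assms(1) hc; simp)+
  have norm_a: "norm (complex_of_real (\<omega> z) - h1 z) = \<bar>a z\<bar>" if "z \<in> unit_disk" for z
    using real(1)[OF that] by (simp add: cmod_eq_Re a_def)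
  have norm_b: "norm (complex_of_real (\<omega> z) - h2 z) = \<bar>b z\<bar>" if "z \<in> unit_disk" for z
    using real(2)[OF that] by (simp add: cmod_eq_Re b_def)
  have int_a: "(\<integral>z. norm (complex_of_real (\<omega> z) - h1 z) \<partial>?D) = (\<integral>z. \<bar>a z\<bar> \<partial>?D)"
    by (rule Bochner_Integration.integral_cong) (auto simp: norm_a)
  have int_b: "(\<integral>z. norm (complex_of_real (\<omega> z) - h2 z) \<partial>?D) = (\<integral>z. \<bar>b z\<bar> \<partial>?D)"
    by (rule Bochner_Integration.integral_cong) (auto simp: norm_b)
  have ab: "(\<integral>z. \<bar>a z\<bar> \<partial>?D) = (\<integral>z. \<bar>b z\<bar> \<partial>?D)"
    using le1[OF H(2)] le2[OF H(1)] by (simp add: int_a int_b)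
  \<comment> \<open>The competitor is the midpoint \<open>m\<close> minus \<open>t\<close> times the
    real part of \<open>g\<close>; its error is \<open>f + t * Re g\<close>.\<close>
  have opt: "(\<integral>z. \<bar>a z\<bar> \<partial>?D) \<le> (\<integral>z. \<bar>f z + t * Re (g z)\<bar> \<partial>?D)" if g: "g \<in> L1_harmonic" for g t
  proof -
    define m where "m = (\<lambda>z. complex_of_real (Re ((1/2) * h1 z + (1/2) * h2 z)))"
    have "(\<lambda>z. 1 * m z + (- of_real t) * of_real (Re (g z))) \<in> L1_harmonic"
      unfolding m_def by (intro L1_harmonic_lincomb L1_harmonic_Re H g)
    note le1[OF this]
    also have "(\<integral>z. norm (complex_of_real (\<omega> z) - (1 * m z + (- of_real t) * of_real (Re (g z)))) \<partial>?D)
        = (\<integral>z. \<bar>f z + t * Re (g z)\<bar> \<partial>?D)"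
    proof (intro Bochner_Integration.integral_cong refl)
      fix z
      have "complex_of_real (\<omega> z) - (1 * m z + (- of_real t) * of_real (Re (g z))) = of_real (f z + t * Re (g z))"
        by (simp add: complex_eq_iff m_def f_def a_def b_def field_simps)
      then show "norm (complex_of_real (\<omega> z) - (1 * m z + (- of_real t) * of_real (Re (g z)))) = \<bar>f z + t * Re (g z)\<bar>"
        by (simp only: norm_of_real)
    qed
    finally show ?thesis by (simp only: int_a)
  qed
  have eq: "\<bar>f z\<bar> = (\<bar>a z\<bar> + \<bar>b z\<bar>) / 2" if z: "z \<in> unit_disk" for z
  proof (rule integral_le_imp_eq_on_open[OF open_ball _ _ _ _ _ _ z])
    show "continuous_on unit_disk (\<lambda>z. \<bar>f z\<bar>)" "continuous_on unit_disk (\<lambda>z. (\<bar>a z\<bar> + \<bar>b z\<bar>) / 2)"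
      by (intro continuous_intros ab_cont; simp)+
    \<comment> \<open>With \<open>t = 0\<close> the choice of \<open>g\<close> does not matter:
      \<open>opt\<close> says that the midpoint cannot beat the common minimal value.\<close>
    show "(\<integral>z. (\<bar>a z\<bar> + \<bar>b z\<bar>) / 2 \<partial>?D) \<le> (\<integral>z. \<bar>f z\<bar> \<partial>?D)"
      using opt[OF H(1), of 0] ab ab_int by simp
  qed (use ab_int in \<open>auto simp: f_def\<close>)
  have nz: "f z \<noteq> 0" if z: "z \<in> unit_disk" "Re (F z) \<noteq> 0" for z
  proof
    assume "f z = 0"
    then have "a z = 0" "b z = 0" using eq[OF z(1)] by auto
    then have "Re (h1 z - h2 z) = 0" by (simp add: a_def b_def)
    then show False using hF[OF z(1)] z(2) by simp
  qed
  have ae: "AE z in ?D. f z \<noteq> 0"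
  proof (rule AE_mp[OF AE_lebesgue_on_notin_negligible[OF N]])
    show "AE z in ?D. z \<notin> N \<longrightarrow> f z \<noteq> 0"
      using nz by (intro AE_I2) (auto simp: N_def)
  qed simp

  define \<sigma> where "\<sigma> = (\<lambda>z. complex_of_real (sgn (f z)))"
  have fm [measurable]: "f \<in> borel_measurable ?D" using ab_int(3) by auto
  have \<sigma>m [measurable]: "\<sigma> \<in> borel_measurable ?D"
    unfolding \<sigma>_def sgn_if by measurable
  have \<sigma>1: "norm (\<sigma> z) \<le> 1" for z by (simp add: \<sigma>_def sgn_if)
  have orth_Re: "(\<integral>z. sgn (f z) * Re (g z) \<partial>?D) = 0" if "g \<in> L1_harmonic" for g
  proof (rule integral_sgn_mult_eq_0[OF ab_int(3) _ ae])
    show "integrable ?D (\<lambda>z. Re (g z))" using L1_harmonic_integrable[OF that] by simp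
    have "(\<integral>z. \<bar>f z\<bar> \<partial>?D) \<le> (\<integral>z. (\<bar>a z\<bar> + \<bar>b z\<bar>) / 2 \<partial>?D)"
      using ab_int by (intro integral_mono) (auto simp: eq)
    also have "\<dots> = (\<integral>z. \<bar>a z\<bar> \<partial>?D)" using ab ab_int by simp
    finally show "(\<integral>z. \<bar>f z\<bar> \<partial>?D) \<le> (\<integral>z. \<bar>f z + t * Re (g z)\<bar> \<partial>?D)" for t
      using opt[OF that, of t] by (rule order_trans)
  qed
  have orth: "(\<integral>z. \<sigma> z * g z \<partial>?D) = 0" if g: "g holomorphic_on unit_disk" "integrable ?D g" for g
  proof -
    have i: "integrable ?D (\<lambda>z. \<sigma> z * g z)"
      by (rule Bochner_Integration.integrable_bound[OF g(2)])
        (use \<sigma>1 g(2) in \<open>auto simp: norm_mult mult_left_le_one_le\<close>)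
    \<comment> \<open>The real part of \<open>- \<i> * g\<close> is the imaginary part of
      \<open>g\<close>, so two real orthogonality relations give the complex one.\<close>
    have "(\<lambda>z. - \<i> * g z) \<in> L1_harmonic"
      using g by (intro holomorphic_in_L1_harmonic holomorphic_intros) auto
    from orth_Re[OF this] orth_Re[OF holomorphic_in_L1_harmonic[OF g]]
    have "Re (\<integral>z. \<sigma> z * g z \<partial>?D) = 0" "Im (\<integral>z. \<sigma> z * g z \<partial>?D) = 0"
      using i by (auto simp: \<sigma>_def integral_Re[symmetric] integral_Im[symmetric] simp del: integral_Re integral_Im)
    then show ?thesis by (simp add: complex_eq_iff)
  qed
  have D: "unit_disk \<in> lmeasurable" by simp
  \<comment> \<open>For \<open>z\<close> on the circle the pole of the kernel lies outside the open
    disk, so the kernel is an admissible holomorphic test function: unbounded, yet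
    integrable.\<close>
  have K0: "cauchy_transform unit_disk \<sigma> 0 z = 0" if "norm z = 1" for z
    unfolding cauchy_transform_def
  proof (rule orth)
    show "(\<lambda>\<zeta>. cauchy_kernel 0 (z - \<zeta>)) holomorphic_on unit_disk"
      unfolding cauchy_kernel_def using that by (auto intro!: holomorphic_intros)
    show "integrable ?D (\<lambda>\<zeta>. cauchy_kernel 0 (z - \<zeta>))"
      using integrable_cauchy[OF D, of "\<lambda>_. 1" 0 z] by simp
  qed
  have K: "norm (z * cauchy_transform unit_disk \<sigma> 0 z) = pi * (1 - (norm z)\<^sup>2)"
    if "z \<in> unit_disk" "Re (F z) \<noteq> 0" for z
    by (rule norm_cauchy_transform_sgn[where f = f, folded \<sigma>_def, OF ab_cont(3) \<sigma>m K0 F FM nz that])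
  have "bounded (cauchy_transform unit_disk \<sigma> 0 ` cball 0 1)"
    by (intro compact_imp_bounded compact_continuous_image cauchy_transform_continuous D \<sigma>m \<sigma>1 compact_cball)
  then obtain C where C: "C > 0" "\<And>z. z \<in> cball 0 1 \<Longrightarrow> norm (cauchy_transform unit_disk \<sigma> 0 z) \<le> C"
    unfolding bounded_pos by auto
  \<comment> \<open>Small enough that \<open>norm (z * K z)\<close> is below 1 on the disk of radius
    \<open>d\<close>, where \<open>K\<close> is the Cauchy transform, and that
    \<open>norm z \<le> 1 / 2\<close> makes \<open>pi * (1 - (norm z)\<^sup>2)\<close> at least 9/4.
    The null set \<open>N\<close> cannot fill that disk, so some \<open>z\<close> meets both
    bounds.\<close>
  define d where "d = 1 / (2 + C)"
  have d: "0 < d" "d \<le> 1 / 2" "d * C < 1" using C by (auto simp: d_def field_simps)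
  have "\<not> negligible (ball (0::complex) d)" using d by (intro open_not_negligible) auto
  then obtain z where z: "z \<in> ball 0 d" "z \<notin> N" using N negligible_subset by blast
  then have zD: "z \<in> unit_disk" "Re (F z) \<noteq> 0" using d by (auto simp: N_def)
  have "norm z \<le> 1 / 2" using z d by auto
  then have "(norm z)\<^sup>2 \<le> (1 / 2)\<^sup>2" by (intro power_mono) auto
  then have "3 * (3 / 4) \<le> pi * (1 - (norm z)\<^sup>2)"
    using pi_gt3 by (intro mult_mono) (auto simp: power2_eq_square)
  also have "\<dots> = norm (z * cauchy_transform unit_disk \<sigma> 0 z)" by (rule K[OF zD, symmetric])
  also have "\<dots> \<le> d * C"
    unfolding norm_mult using z zD d C by (intro mult_mono) auto
  finally show False using d by simp
qed

end
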